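(* Let $n\ge2$ and $\gamma\in\mathbb R$. For every $f\in\mathcal S_r(\mathbb R^{n-1}\times\mathbb R^{n-1})$ with $f(\mathbf x,\mathbf y)=\mathbf f(\mathbf x,|\mathbf y|)$, $$\|f\|_\gamma\le(2\pi)^{\frac{1-n}2}\|Cf\|_{\gamma+\frac{n-1}2}\qquad\text{and}\qquad\|\mathbf f\|_{\gamma,n-2}\le(2\pi)^{\frac{1-n}2}\|\mathcal C\mathbf f\|_{\gamma+\frac{n-1}2,\,n-2}.$$
   Context: $\mathcal S_r(\mathbb R^{n-1}\times\mathbb R^{n-1})$ is the set of Schwartz functions $f\in\mathcal S(\mathbb R^{2(n-1)})$ with $f(\mathbf x,\mathbf y)=f(\mathbf x,U\mathbf y)$ for all $(\mathbf x,\mathbf y)$ and all orthogonal transformations $U$ of $\mathbb R^{n-1}$. The cone transform is $Cf(\mathbf u,\mathbf v)=\int_{\mathbb R^{n-1}}f(\mathbf u+|\mathbf v|\mathbf y,\mathbf y)\,d\mathbf y$. For $\mathbf f$ on $\mathbb R^{n-1}\times[0,\infty)$, $$\mathcal C\mathbf f(\mathbf u,s)=\int_{S^{n-2}}\int_0^\infty\mathbf f(\mathbf u+zs\boldsymbol\theta,z)z^{n-2}\,dz\,dS(\boldsymbol\theta)\ (n\ge3),\qquad \mathcal C\mathbf f(u,s)=\int_0^\infty\big(\mathbf f(u+zs,z)+\mathbf f(u-zs,z)\big)dz\ (n=2),$$ so $Cf(\mathbf u,\mathbf v)=\mathcal C\mathbf f(\mathbf u,|\mathbf v|)$. $\mathcal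 F$ is the $2(n-1)$-dimensional Fourier transform and $\mathcal F_1$ the $(n-1)$-dimensional Fourier transform in the first variable (convention $\int e^{-ix\cdot\xi}g(x)\,dx$). The norms, with values in $[0,\infty]$, are $$\|f\|_\gamma^2=\int_{\mathbb R^{n-1}}\int_{\mathbb R^{n-1}}|\mathcal Ff(\boldsymbol\xi,\boldsymbol\eta)|^2(1+|\boldsymbol\xi|^2)^\gamma\,d\boldsymbol\xi\,d\boldsymbol\eta,\qquad \|\mathbf f\|_{\gamma,n-2}^2=\int_{\mathbb R^{n-1}}\int_0^\infty|\mathcal F_1\mathbf f(\boldsymbol\xi,z)|^2(1+|\boldsymbol\xi|^2)^\gamma z^{n-2}\,dz\,d\boldsymbol\xi.$$ For $Cf$, $\mathcal F(Cf)(\boldsymbol\xi,\cdot)$ is understood, for $\boldsymbol\xi\ne0$, as the Fourier transform in $\mathbf v$ of $\mathcal F_1(Cf)(\boldsymbol\xi,\mathbf v)$. *)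

theory Defs
  imports "HOL-Analysis.Analysis"
begin

primrec iter_deriv ::
  "('a::euclidean_space \<Rightarrow> 'b::real_normed_vector) \<Rightarrow> 'a list \<Rightarrow> 'a \<Rightarrow> 'b" where
  "iter_deriv f [] = f"
| "iter_deriv f (b # bs) = (\<lambda>x. frechet_derivative (iter_deriv f bs) (at x) b)"

text \<open>
  Smoothness is expressed by requiring every iterated partial derivative to be Frechet
  differentiable everywhere, which makes \<open>frechet_derivative\<close> in \<open>iter_deriv\<close> meaningful
  at every stage.
\<close>

definition schwartz :: "('a::euclidean_space \<Rightarrow> complex) set" where
  "schwartz = {f. \<forall>bs. set bs \<subseteq> Basis \<longrightarrow>
      (\<forall>x. iter_deriv f bs differentiable (at x)) \<and>
      (\<forall>k::nat. bounded (range (\<lambda>x. norm x ^ k *\<^sub>R iter_deriv f bs x)))}"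

definition schwartz_r ::
  "((real^'m::finite) \<times> (real^'m) \<Rightarrow> complex) set" where
  "schwartz_r = {f \<in> schwartz.
      \<forall>U. orthogonal_transformation U \<longrightarrow> (\<forall>x y. f (x, y) = f (x, U y))}"

definition cone_transform ::
  "((real^'m::finite) \<times> (real^'m) \<Rightarrow> complex) \<Rightarrow> (real^'m) \<times> (real^'m) \<Rightarrow> complex" where
  "cone_transform f = (\<lambda>(u, v). LINT y|lborel. f (u + norm v *\<^sub>R y, y))"

text \<open>
  Surface measure on the unit sphere: \<open>\<sigma>(A)\<close> is the dimension times the Lebesgue measure
  of the cone \<open>{r \<theta>. 0 < r \<le> 1, \<theta> \<in> A}\<close>, see \<open>emeasure_sphere_measure\<close> below.
\<close>

definition sphere_measure :: "'a::euclidean_space measure" where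
  "sphere_measure = scale_measure (of_nat DIM('a))
     (distr (restrict_space lborel (cball 0 1 - {0})) (restrict_space borel (sphere 0 1)) sgn)"

lemma space_sphere_measure: "space (sphere_measure :: 'a::euclidean_space measure) = sphere 0 1"
  by (simp add: sphere_measure_def space_scale_measure space_restrict_space)

lemma sets_sphere_measure:
  "sets (sphere_measure :: 'a::euclidean_space measure) = sets (restrict_space borel (sphere 0 1))"
  by (simp add: sphere_measure_def)

lemma emeasure_sphere_measure:
  fixes A :: "'a::euclidean_space set"
  assumes "A \<in> sets borel" "A \<subseteq> sphere 0 1"
  shows "emeasure sphere_measure A =
    of_nat DIM('a) * emeasure lborel {r *\<^sub>R \<theta> | r \<theta>. 0 < r \<and> r \<le> 1 \<and> \<theta> \<in> A}"
proof -
  have m: "(sgn :: 'a \<Rightarrow> 'a) \<in> restrict_space lborel (cball 0 1 - {0}) \<rightarrow>\<^sub>M restrict_space borel (sphere 0 1)"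
    by (intro measurable_restrict_space2 measurable_restrict_space1)
       (auto simp: space_restrict_space norm_sgn)
  have A: "A \<in> sets (restrict_space borel (sphere 0 1))"
    using assms by (auto simp: sets_restrict_space_iff)
  have "{r *\<^sub>R \<theta> | r \<theta>. 0 < r \<and> r \<le> 1 \<and> \<theta> \<in> A} = sgn -` A \<inter> (cball 0 1 - {0})" (is "?L = ?R")
  proof
    show "?L \<subseteq> ?R"
      using assms(2) by (force simp: sgn_scaleR sgn_div_norm)
    show "?R \<subseteq> ?L"
    proof
      fix x assume x: "x \<in> ?R"
      then have "x = norm x *\<^sub>R sgn x" "0 < norm x" "norm x \<le> 1" "sgn x \<in> A"
        by (auto simp: sgn_div_norm)
      then show "x \<in> ?L" by blast
    qed
  qed
  then show ?thesis
    using m A by (simp add: sphere_measure_def emeasure_distr emeasure_restrict_space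
        space_restrict_space)
qed

text \<open>
  Only the values \<open>F (x, z)\<close> with \<open>z \<ge> 0\<close> are used. With
  \<open>CARD('m) = n - 1\<close>, the case \<open>CARD('m) = 1\<close> is \<open>n = 2\<close>, and \<open>vec\<close> identifies the reals with \<open>real^'m\<close>.
\<close>

definition radial_cone_transform ::
  "((real^'m::finite) \<times> real \<Rightarrow> complex) \<Rightarrow> (real^'m) \<times> real \<Rightarrow> complex" where
  "radial_cone_transform F = (\<lambda>(u, s).
     if CARD('m) = 1
     then LINT z:{0..}|lborel. (F (u + vec (z * s), z) + F (u - vec (z * s), z))
     else LINT \<theta>|sphere_measure. (LINT z:{0..}|lborel.
            F (u + (z * s) *\<^sub>R \<theta>, z) * of_real (z ^ (CARD('m) - 1))))"

definition fourier :: "('a::euclidean_space \<Rightarrow> complex) \<Rightarrow> 'a \<Rightarrow> complex" where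
  "fourier g \<xi> = (LINT x|lborel. exp (- \<i> * of_real (x \<bullet> \<xi>)) * g x)"

definition fourier_fst :: "('a::euclidean_space \<times> 'b \<Rightarrow> complex) \<Rightarrow> 'a \<times> 'b \<Rightarrow> complex" where
  "fourier_fst g = (\<lambda>(\<xi>, z). fourier (\<lambda>x. g (x, z)) \<xi>)"

text \<open>
  Fourier transform in the first and then in the second variable. A cone transform need not be
  integrable in \<open>v\<close>, so its joint Fourier integral may fail to exist, whereas this iterated one
  exists for \<open>\<xi> \<noteq> 0\<close>. The slice \<open>\<xi> = 0\<close> is a null set and does not affect the norms below.
\<close>

definition fourier_iter ::
  "('a::euclidean_space \<times> 'b::euclidean_space \<Rightarrow> complex) \<Rightarrow> 'a \<times> 'b \<Rightarrow> complex" where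
  "fourier_iter g = (\<lambda>(\<xi>, \<eta>). fourier (\<lambda>v. fourier_fst g (\<xi>, v)) \<eta>)"

lemma fourier_iter_eq_fourier:
  fixes g :: "'a::euclidean_space \<times> 'b::euclidean_space \<Rightarrow> complex"
  assumes "integrable lborel g"
  shows "fourier_iter g = fourier g"
proof
  fix p :: "'a \<times> 'b"
  obtain \<xi> \<eta> where p: "p = (\<xi>, \<eta>)" by fastforce
  let ?h = "\<lambda>x. exp (- \<i> * of_real (x \<bullet> p)) * g x"
  have [measurable]: "g \<in> borel_measurable lborel" using assms by simp
  have "integrable lborel ?h"
    by (rule Bochner_Integration.integrable_bound[OF assms]) (auto simp: norm_mult)
  then have "integrable (lborel \<Otimes>\<^sub>M lborel) (\<lambda>(x, y). ?h (x, y))"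
    by (simp add: lborel_prod split_beta')
  from lborel_pair.integral_snd[OF this] have "fourier g p = (LINT v|lborel. LINT u|lborel. ?h (u, v))"
    by (simp add: fourier_def lborel_prod split_beta')
  also have "\<dots> = fourier_iter g p"
    by (simp add: fourier_iter_def fourier_fst_def fourier_def p algebra_simps exp_diff exp_minus
        divide_inverse flip: integral_mult_right_zero)
  finally show "fourier_iter g p = fourier g p" ..
qed

definition ennreal_sqrt :: "ennreal \<Rightarrow> ennreal" where
  "ennreal_sqrt x = (if x = top then top else ennreal (sqrt (enn2real x)))"

lemma ennreal_sqrt_mult_self: "ennreal_sqrt x * ennreal_sqrt x = x"
  by (cases x) (auto simp: ennreal_sqrt_def ennreal_mult_top simp flip: ennreal_mult)

text \<open>
  \<open>aniso_norm\<close> takes the Fourier transform of the function whose norm is meant, since that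
  transform is \<open>fourier\<close> for Schwartz functions but \<open>fourier_iter\<close> for cone transforms.
\<close>

definition aniso_norm :: "real \<Rightarrow> ((real^'m::finite) \<times> (real^'m) \<Rightarrow> complex) \<Rightarrow> ennreal" where
  "aniso_norm \<gamma> G = ennreal_sqrt
     (\<integral>\<^sup>+\<xi>. \<integral>\<^sup>+\<eta>. ennreal ((cmod (G (\<xi>, \<eta>)))\<^sup>2 * (1 + (norm \<xi>)\<^sup>2) powr \<gamma>) \<partial>lborel \<partial>lborel)"

definition radial_norm ::
  "real \<Rightarrow> nat \<Rightarrow> ((real^'m::finite) \<times> real \<Rightarrow> complex) \<Rightarrow> ennreal" where
  "radial_norm \<gamma> k F = ennreal_sqrt
     (\<integral>\<^sup>+\<xi>. (\<integral>\<^sup>+z\<in>{0..}. ennreal ((cmod (fourier_fst F (\<xi>, z)))\<^sup>2 *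
        (1 + (norm \<xi>)\<^sup>2) powr \<gamma> * z ^ k) \<partial>lborel) \<partial>lborel)"

end

theory Submission
  imports Defs "HOL-Probability.Probability"
begin

text \<open>
  Write \<open>d = n - 1\<close> and \<open>g \<xi> y = fourier_fst f (\<xi>, y)\<close>. Shifting the first variable in
  the cone integral gives \<open>fourier_fst (cone_transform f) (\<xi>, v) = fourier f (\<xi>, - |v| \<xi>)\<close>, which by
  rotation invariance is \<open>fourier f (\<xi>, |\<xi>| v)\<close>. So at fixed \<open>\<xi> \<noteq> 0\<close> the cone transform acts as
  the Fourier transform of \<open>g \<xi>\<close> followed by a dilation by \<open>|\<xi>|\<close>: Plancherel turns the squared
  \<open>L\<^sup>2\<close> norms of the \<open>\<xi>\<close>-slices into one another up to the factor \<open>(2 pi / |\<xi>|) ^ d\<close>, and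
  \<open>|\<xi>| ^ d \<le> (1 + |\<xi>|\<^sup>2) powr (d / 2)\<close>. The radial norms follow through polar coordinates.
\<close>

subsection \<open>Lebesgue measure under affine and orthogonal maps\<close>

text \<open>A cone transform need not be integrable in \<open>v\<close>, so the Plancherel formula
  is never applied to it directly. It is applied to the partial transform of the Schwartz function,
  and the iterated transform of the cone transform comes from inverting a dilated slice of
  \<open>fourier f\<close>, which is integrable. Every relation between slices at fixed
  \<open>\<xi> \<noteq> 0\<close> is an equality; only the weight estimate loses something, and it
  does so at low frequencies. The constant has the same source in both estimates. In the anisotropic
  norms a slice carries \<open>(2 * pi) ^ d\<close> for \<open>f\<close> and
  \<open>(2 * pi) ^ (2 * d)\<close> for the cone transform; in the radial norms, which leave the
  second variable untransformed, the factors are 1 and \<open>(2 * pi) ^ d\<close>. The ratio is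
  \<open>(2 * pi) ^ d\<close> each time, and its inverse square root is the constant of the theorem.
  The reciprocal of \<open>norm \<xi> ^ d\<close> is not integrable near the origin, so the norms on
  the right can be infinite; hence the comparison of nonnegative extended integrals slice by
  slice.\<close>

lemma nn_integral_lborel_affine:
  fixes f :: "'a::euclidean_space \<Rightarrow> ennreal"
  assumes [measurable]: "f \<in> borel_measurable borel" and c: "c \<noteq> 0"
  shows "(\<integral>\<^sup>+x. f x \<partial>lborel) = ennreal (\<bar>c\<bar> ^ DIM('a)) * (\<integral>\<^sup>+x. f (t + c *\<^sub>R x) \<partial>lborel)"
  by (subst lborel_affine[OF c, of t])
     (simp add: nn_integral_density nn_integral_distr nn_integral_cmult)

lemma integral_lborel_affine:
  fixes f :: "'a::euclidean_space \<Rightarrow> 'b::{banach, second_countable_topology}"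
  assumes [measurable]: "f \<in> borel_measurable borel" and c: "c \<noteq> 0"
  shows "(\<integral>x. f x \<partial>lborel) = \<bar>c\<bar> ^ DIM('a) *\<^sub>R (\<integral>x. f (t + c *\<^sub>R x) \<partial>lborel)"
  by (subst lborel_affine[OF c, of t])
     (simp add: integral_density integral_distr)

lemma integrable_lborel_affine:
  fixes f :: "'a::euclidean_space \<Rightarrow> 'b::{banach, second_countable_topology}"
  assumes f: "integrable lborel f" and c: "c \<noteq> 0"
  shows "integrable lborel (\<lambda>x. f (t + c *\<^sub>R x))"
proof -
  have [measurable]: "f \<in> borel_measurable borel"
    using borel_measurable_integrable[OF f] by simp
  have "integrable (density (distr lborel borel (\<lambda>x. t + c *\<^sub>R x)) (\<lambda>_. \<bar>c\<bar> ^ DIM('a))) f"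
    using f lborel_affine[OF c, of t] by metis
  then show ?thesis
    using c integrable_scaleR_right[of "inverse (\<bar>c\<bar> ^ DIM('a))" lborel
        "\<lambda>x. \<bar>c\<bar> ^ DIM('a) *\<^sub>R f (t + c *\<^sub>R x)"]
    by (simp add: integrable_density integrable_distr_eq)
qed

text \<open>The image measure is again translation invariant and agrees with \<open>lborel\<close> on the unit ball;
  the usual Tonelli argument for uniqueness of Haar measure then gives equality.\<close>

lemma lborel_distr_orthogonal:
  fixes U :: "'a::euclidean_space \<Rightarrow> 'a"
  assumes U: "orthogonal_transformation U"
  shows "distr lborel borel U = lborel"
proof (rule measure_eqI)
  let ?M = "distr lborel borel U" and ?B = "ball (0::'a) 1"
  have lin: "linear U" and iso: "\<And>x. norm (U x) = norm x"
    using U by (auto simp: orthogonal_transformation)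
  have bij: "bij U" using U orthogonal_transformation_bij by blast
  have [measurable]: "U \<in> borel \<rightarrow>\<^sub>M borel"
    by (intro borel_measurable_continuous_onI linear_continuous_on linear_conv_bounded_linear[THEN iffD1] lin)
  \<comment> \<open>Tonelli for \<open>lborel\<close> and \<open>?M\<close> requires
    sigma-finiteness of \<open>?M\<close>, which is transported back from \<open>lborel\<close>
    along the inverse map.\<close>
  interpret M: sigma_finite_measure ?M
  proof -
    have V: "inv U \<in> borel \<rightarrow>\<^sub>M borel"
      using orthogonal_transformation_inv[OF U]
      by (auto intro!: borel_measurable_continuous_onI linear_continuous_on
          linear_conv_bounded_linear[THEN iffD1] simp: orthogonal_transformation_def)
    have "distr ?M lborel (inv U) = lborel"
      using V by (subst distr_distr) (auto simp: o_def inv_f_f[OF bij_is_inj[OF bij]]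
          distr_id2[symmetric])
    then have "sigma_finite_measure (distr ?M lborel (inv U))"
      using sigma_finite_lborel by metis
    then show "sigma_finite_measure ?M"
      using V by (intro sigma_finite_measure_distr[of ?M lborel "inv U"]) simp_all
  qed
  interpret P: pair_sigma_finite lborel ?M ..
  have trans: "(\<integral>\<^sup>+y. h (y + x) \<partial>?M) = (\<integral>\<^sup>+y. h y \<partial>?M)"
    if [measurable]: "h \<in> borel_measurable borel" for h :: "'a \<Rightarrow> ennreal" and x
  proof -
    \<comment> \<open>By linearity, translating the image measure by \<open>x\<close> amounts to
      translating \<open>lborel\<close> by the preimage of \<open>x\<close>.\<close>
    obtain z where z: "x = U z" using bij by (metis bij_pointE)
    have "(\<integral>\<^sup>+y. h (y + x) \<partial>?M) = (\<integral>\<^sup>+y. h (U (z + 1 *\<^sub>R y)) \<partial>lborel)"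
      by (simp add: nn_integral_distr z linear_add[OF lin] add.commute)
    also have "\<dots> = (\<integral>\<^sup>+y. h (U y) \<partial>lborel)"
      using nn_integral_lborel_affine[of "\<lambda>y. h (U y)" 1 z] by simp
    also have "\<dots> = (\<integral>\<^sup>+y. h y \<partial>?M)"
      by (simp add: nn_integral_distr)
    finally show ?thesis .
  qed
  show "emeasure ?M A = emeasure lborel A" if "A \<in> sets ?M" for A
  proof -
    have [measurable]: "A \<in> sets borel" using that by simp
    have iB: "indicator ?B (x - y) = (indicator ?B (y - x) :: ennreal)" for x y :: 'a
      by (simp add: indicator_def norm_minus_commute)
    have [measurable, simp]: "(indicator ?B :: 'a \<Rightarrow> ennreal) \<in> borel_measurable borel"
      by (rule borel_measurable_indicator) simp
    have "(\<lambda>y. indicator ?B (U y) :: ennreal) = indicator ?B"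
      by (simp add: fun_eq_iff indicator_def iso)
    then have Bm: "(\<integral>\<^sup>+y. indicator ?B y \<partial>?M) = (\<integral>\<^sup>+y. indicator ?B y \<partial>lborel)"
      by (subst nn_integral_distr) (auto intro!: borel_measurable_indicator simp del: nn_integral_indicator)
    have "emeasure lborel ?B * emeasure ?M A = (\<integral>\<^sup>+x. indicator ?B x * (\<integral>\<^sup>+y. indicator A y \<partial>?M) \<partial>lborel)"
      by (simp add: nn_integral_multc)
    also have "\<dots> = (\<integral>\<^sup>+x. \<integral>\<^sup>+y. indicator ?B x * indicator A (y + x) \<partial>?M \<partial>lborel)"
      by (simp add: nn_integral_cmult trans)
    also have "\<dots> = (\<integral>\<^sup>+y. \<integral>\<^sup>+x. indicator ?B x * indicator A (y + x) \<partial>lborel \<partial>?M)"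
      by (rule P.Fubini'[symmetric]) simp
    also have "\<dots> = (\<integral>\<^sup>+y. \<integral>\<^sup>+x. indicator ?B (x - y) * indicator A x \<partial>lborel \<partial>?M)"
    proof (rule nn_integral_cong)
      fix y
      show "(\<integral>\<^sup>+x. indicator ?B x * indicator A (y + x) \<partial>lborel)
          = (\<integral>\<^sup>+x. indicator ?B (x - y) * indicator A x \<partial>lborel)"
        using nn_integral_lborel_affine[of "\<lambda>x. indicator ?B (x - y) * indicator A x" 1 y] by simp
    qed
    also have "\<dots> = (\<integral>\<^sup>+x. \<integral>\<^sup>+y. indicator ?B (x - y) * indicator A x \<partial>?M \<partial>lborel)"
      by (rule P.Fubini') simp
    also have "\<dots> = (\<integral>\<^sup>+x. (\<integral>\<^sup>+y. indicator ?B (y + - x) \<partial>?M) * indicator A x \<partial>lborel)"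
      by (simp add: nn_integral_multc iB)
    also have "\<dots> = emeasure lborel ?B * emeasure lborel A"
      by (subst trans) (simp_all add: Bm nn_integral_cmult)
    finally show ?thesis
      using emeasure_lborel_ball_finite[of "0::'a" 1] content_ball_pos[of 1 "0::'a"]
      by (auto simp: ennreal_mult_cancel_left emeasure_eq_ennreal_measure)
  qed
qed simp

subsection \<open>Decay of Schwartz functions and their Fourier transforms\<close>

text \<open>The exponent \<open>DIM('a)\<close> serves two ends: the weight is dominated by the
  product over the coordinates of \<open>1 / (1 + t^2)\<close>, hence integrable, and it is
  submultiplicative on product spaces because dimensions add.\<close>

definition decay :: "'a::euclidean_space \<Rightarrow> real" where
  "decay x = inverse ((1 + (norm x)\<^sup>2) ^ DIM('a))"

lemma decay_pos: "0 < decay x"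
  unfolding decay_def by (simp add: add_pos_nonneg)

lemma decay_measurable [measurable]: "decay \<in> borel_measurable borel"
  unfolding decay_def by measurable

lemma integrable_decay: "integrable lborel (decay :: 'a::euclidean_space \<Rightarrow> real)"
proof (rule integrableI_bounded)
  have int: "integrable lborel (\<lambda>t::real. inverse (1 + t\<^sup>2))"
    using integrable_inverse_1_plus_square by (simp add: set_integrable_def einterval_def)
  then have fin: "(\<integral>\<^sup>+t. ennreal (inverse (1 + t\<^sup>2)) \<partial>lborel) < \<infinity>"
    by (simp add: integrable_iff_bounded)
  have le: "decay x \<le> (\<Prod>b\<in>Basis. inverse (1 + (x \<bullet> b)\<^sup>2))" for x :: 'a
  proof -
    have "(\<Prod>b\<in>Basis. 1 + (x \<bullet> b)\<^sup>2) \<le> (\<Prod>b\<in>(Basis::'a set). 1 + (norm x)\<^sup>2)"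
    proof (intro prod_mono conjI)
      fix b :: 'a assume "b \<in> Basis"
      then have "\<bar>x \<bullet> b\<bar> \<le> norm x" by (rule Basis_le_norm)
      then show "1 + (x \<bullet> b)\<^sup>2 \<le> 1 + (norm x)\<^sup>2" using abs_le_square_iff by fastforce
    qed simp
    moreover have "0 < (\<Prod>b\<in>(Basis::'a set). 1 + (x \<bullet> b)\<^sup>2)"
      by (intro prod_pos) (simp add: add_pos_nonneg)
    ultimately show ?thesis
      by (simp add: decay_def prod_inversef[unfolded o_def] le_imp_inverse_le)
  qed
  have "(\<integral>\<^sup>+x. ennreal (norm (decay (x::'a))) \<partial>lborel)
      \<le> (\<integral>\<^sup>+x. (\<Prod>b\<in>Basis. ennreal (inverse (1 + ((x::'a) \<bullet> b)\<^sup>2))) \<partial>lborel)"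
    using le decay_pos by (intro nn_integral_mono) (simp add: prod_ennreal ennreal_leI abs_of_pos[OF decay_pos])
  also have "\<dots> = (\<Prod>b\<in>(Basis::'a set). \<integral>\<^sup>+t. ennreal (inverse (1 + t\<^sup>2)) \<partial>lborel)"
    by (rule nn_integral_lborel_prod) auto
  also have "\<dots> < \<infinity>"
    using fin by (simp add: power_less_top_ennreal)
  finally show "(\<integral>\<^sup>+x. ennreal (norm (decay (x::'a))) \<partial>lborel) < \<infinity>" .
qed simp

lemma decay_prod_le: "decay (x::'a::euclidean_space, y::'b::euclidean_space) \<le> decay x * decay y"
proof -
  have "(1 + (norm x)\<^sup>2) ^ DIM('a) * (1 + (norm y)\<^sup>2) ^ DIM('b)
      \<le> (1 + (norm (x, y))\<^sup>2) ^ DIM('a) * (1 + (norm (x, y))\<^sup>2) ^ DIM('b)"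
    by (intro mult_mono power_mono) (auto simp: norm_Pair)
  then have "(1 + (norm x)\<^sup>2) ^ DIM('a) * (1 + (norm y)\<^sup>2) ^ DIM('b) \<le> (1 + (norm (x, y))\<^sup>2) ^ DIM('a \<times> 'b)"
    by (simp add: power_add)
  moreover have "0 < (1 + (norm x)\<^sup>2) ^ DIM('a) * (1 + (norm y)\<^sup>2) ^ DIM('b)"
    by (simp add: add_pos_nonneg)
  ultimately show ?thesis
    unfolding decay_def by (metis inverse_mult_distrib le_imp_inverse_le)
qed

lemma decay_le_1: "decay x \<le> 1"
  unfolding decay_def by (simp add: inverse_le_1_iff)

lemma decay_Pair_le: "decay (x, y) \<le> decay x" "decay (x, y) \<le> decay y"
  using decay_prod_le[of x y] mult_left_le[OF decay_le_1 less_imp_le[OF decay_pos], of y x]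
    mult_left_le[OF decay_le_1 less_imp_le[OF decay_pos], of x y]
  by (auto simp: mult.commute)

text \<open>Since \<open>1 + s \<le> 2 * max 1 s\<close>, bounds against the powers 0 and
  \<open>2 * DIM('a)\<close> of the norm control the whole weight. This turns the moment bounds in
  \<open>schwartz\<close>, and later those for the Fourier transform, into one integrable
  majorant.\<close>

lemma decay_bound:
  fixes h :: "'a::euclidean_space \<Rightarrow> 'b::real_normed_vector"
  assumes "\<And>x. norm (h x) \<le> A" and "\<And>x. norm x ^ (2 * DIM('a)) * norm (h x) \<le> B"
  shows "norm (h x) \<le> 2 ^ DIM('a) * (A + B) * decay x"
proof -
  let ?s = "(norm x)\<^sup>2" and ?d = "DIM('a)"
  have "(1 + ?s) ^ ?d \<le> (2 * max 1 ?s) ^ ?d"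
    by (intro power_mono) auto
  also have "\<dots> \<le> 2 ^ ?d * (1 + ?s ^ ?d)"
    by (auto simp: power_mult_distrib max_def)
  finally have "(1 + ?s) ^ ?d * norm (h x) \<le> 2 ^ ?d * (1 + ?s ^ ?d) * norm (h x)"
    by (intro mult_right_mono) auto
  also have "\<dots> = 2 ^ ?d * (norm (h x) + norm x ^ (2 * ?d) * norm (h x))"
    by (subst power_mult) (simp add: algebra_simps)
  also have "\<dots> \<le> 2 ^ ?d * (A + B)"
    using assms[of x] by (intro mult_left_mono add_mono) auto
  moreover have "0 < (1 + ?s) ^ ?d" by (simp add: add_pos_nonneg)
  ultimately show ?thesis
    by (simp add: decay_def field_simps)
qed

lemma iter_deriv_append: "iter_deriv (iter_deriv f cs) bs = iter_deriv f (bs @ cs)"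
  by (induction bs) auto

lemma schwartz_iter_deriv:
  assumes "f \<in> schwartz" "set bs \<subseteq> Basis"
  shows "iter_deriv f bs \<in> schwartz"
  using assms by (auto simp: schwartz_def iter_deriv_append)

lemma schwartz_differentiable: "f \<in> schwartz \<Longrightarrow> f differentiable (at x)"
  unfolding schwartz_def by (auto dest: spec[of _ "[]"])

lemma schwartz_continuous_on: "f \<in> schwartz \<Longrightarrow> continuous_on S f"
  by (meson continuous_at_imp_continuous_on differentiable_imp_continuous_within schwartz_differentiable)

lemma schwartz_measurable: "f \<in> schwartz \<Longrightarrow> f \<in> borel_measurable borel"
  by (intro borel_measurable_continuous_onI schwartz_continuous_on)

lemma schwartz_decay:
  fixes f :: "'a::euclidean_space \<Rightarrow> complex"
  assumes "f \<in> schwartz"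
  obtains C where "0 \<le> C" "\<And>x. cmod (f x) \<le> C * decay x"
proof -
  have "bounded (range (\<lambda>x. norm x ^ k *\<^sub>R f x))" for k
    using assms unfolding schwartz_def by (auto dest: spec[of _ "[]"])
  then have "\<exists>B. \<forall>x. norm x ^ k * cmod (f x) \<le> B" for k
    by (simp add: bounded_iff)
  then obtain B where B: "\<And>k x. norm x ^ k * cmod (f x) \<le> B k" by metis
  have "cmod (f x) \<le> 2 ^ DIM('a) * (B 0 + B (2 * DIM('a))) * decay x" for x
    by (rule decay_bound) (use B[where k=0] B in auto)
  moreover have "0 \<le> B k" for k
    using B[of undefined k] order.trans[of 0] by (meson norm_ge_zero mult_nonneg_nonneg zero_le_power)
  ultimately show ?thesis
    by (intro that[of "2 ^ DIM('a) * (B 0 + B (2 * DIM('a)))"]) auto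
qed

lemma integrable_decay_bound:
  fixes h :: "'a::euclidean_space \<Rightarrow> 'b::{banach, second_countable_topology}"
  assumes "h \<in> borel_measurable borel" "\<And>x. norm (h x) \<le> C * decay x"
  shows "integrable lborel h"
  by (rule Bochner_Integration.integrable_bound[OF integrable_mult_right[OF integrable_decay, of C]])
     (use assms in \<open>auto intro: order.trans[OF _ abs_ge_self]\<close>)

lemma schwartz_integrable:
  assumes "f \<in> schwartz" shows "integrable lborel f"
proof -
  obtain C where "\<And>x. cmod (f x) \<le> C * decay x" using schwartz_decay[OF assms] by blast
  then show ?thesis
    by (intro integrable_decay_bound[where C=C] schwartz_measurable assms)
qed

lemma cmod_fourier_le: "cmod (fourier g \<xi>) \<le> (LINT x|lborel. cmod (g x))"
proof -
  have "cmod (fourier g \<xi>) \<le> (LINT x|lborel. cmod (exp (- \<i> * of_real (x \<bullet> \<xi>)) * g x))"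
    unfolding fourier_def by (rule integral_norm_bound)
  then show ?thesis by (simp add: norm_mult)
qed

lemma integrable_exp_mult:
  fixes g :: "'a::euclidean_space \<Rightarrow> complex"
  assumes "integrable lborel g"
  shows "integrable lborel (\<lambda>x. exp (- \<i> * of_real (x \<bullet> \<xi>)) * g x)"
proof (rule Bochner_Integration.integrable_bound[OF assms])
  have [measurable]: "g \<in> borel_measurable borel" using assms by auto
  show "(\<lambda>x. exp (- \<i> * of_real (x \<bullet> \<xi>)) * g x) \<in> borel_measurable lborel" by measurable
qed (simp add: norm_mult)

text \<open>Integrating \<open>h (x + b) - h x\<close>, written by the fundamental theorem of calculus as
  \<open>\<integral>\<^sub>0\<^sup>1 D (x + t b) dt\<close>, over all \<open>x\<close> gives zero by translation invariance.\<close>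

lemma integral_directional_derivative_eq_0:
  fixes h D :: "'a::euclidean_space \<Rightarrow> complex"
  assumes deriv: "\<And>x. (h has_derivative h' x) (at x)" and D: "\<And>x. D x = h' x b"
    and cont: "continuous_on UNIV D" and h: "integrable lborel h" and iD: "integrable lborel D"
  shows "(LINT x|lborel. D x) = 0"
proof -
  have [measurable]: "D \<in> borel_measurable borel" "h \<in> borel_measurable borel"
    using cont h by (auto intro: borel_measurable_continuous_onI)
  let ?k = "\<lambda>t x. indicator {0..1} t *\<^sub>R D (x + t *\<^sub>R b)"
  have shift: "integrable lborel (\<lambda>x. D (x + t *\<^sub>R b))" "(LINT x|lborel. D (x + t *\<^sub>R b)) = (LINT x|lborel. D x)"
    "(LINT x|lborel. norm (D (x + t *\<^sub>R b))) = (LINT x|lborel. norm (D x))" for t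
    using integrable_lborel_affine[OF iD, of 1 "t *\<^sub>R b"] integral_lborel_affine[of D 1 "t *\<^sub>R b"]
      integral_lborel_affine[of "\<lambda>x. norm (D x)" 1 "t *\<^sub>R b"]
    by (simp_all add: add.commute)
  have ind: "integrable lborel (indicator {0..1::real} :: real \<Rightarrow> real)"
    by (simp add: integrable_indicator_iff)
  have int: "integrable (lborel \<Otimes>\<^sub>M lborel) (\<lambda>(t, x). ?k t x)"
  proof (rule lborel_pair.Fubini_integrable)
    show "integrable lborel (\<lambda>t. LINT x|lborel. norm (case (t, x) of (t, x) \<Rightarrow> ?k t x))"
      using ind by (simp add: shift)
    show "AE t in lborel. integrable lborel (\<lambda>x. case (t, x) of (t, x) \<Rightarrow> ?k t x)"
      by (simp add: shift)
  qed measurable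
  have ftc: "(LINT t|lborel. ?k t x) = h (x + b) - h x" for x
  proof -
    have "(LINT t|lborel. ?k t x) = h (x + 1 *\<^sub>R b) - h (x + 0 *\<^sub>R b)"
    proof (rule integral_FTC_Icc)
      fix t :: real
      have "((\<lambda>t. h (x + t *\<^sub>R b)) has_derivative (\<lambda>s. h' (x + t *\<^sub>R b) (s *\<^sub>R b))) (at t within {0..1})"
        by (rule has_derivative_compose[OF _ deriv, of "\<lambda>t. x + t *\<^sub>R b"])
           (auto intro!: derivative_eq_intros)
      then show "((\<lambda>t. h (x + t *\<^sub>R b)) has_vector_derivative D (x + t *\<^sub>R b)) (at t within {0..1})"
        unfolding has_vector_derivative_def D
        using linear_scale[OF has_derivative_linear[OF deriv]] by simp
    qed (auto intro!: continuous_on_compose2[OF cont] continuous_intros)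
    then show ?thesis by simp
  qed
  have "0 = (LINT x|lborel. h (x + b)) - (LINT x|lborel. h x)"
    using integral_lborel_affine[of h 1 b] by (simp add: add.commute)
  also have "\<dots> = (LINT x|lborel. h (x + b) - h x)"
    using integrable_lborel_affine[OF h, of 1 b] h by (simp add: add.commute)
  also have "\<dots> = (LINT x|lborel. LINT t|lborel. ?k t x)"
    by (simp only: ftc)
  also have "\<dots> = (LINT t|lborel. LINT x|lborel. ?k t x)"
    by (rule lborel_pair.Fubini_integral[OF int])
  also have "\<dots> = (LINT x|lborel. D x)"
    by (simp add: shift)
  finally show ?thesis ..
qed

text \<open>Integration by parts without boundary terms: the directional derivative of the
  exponential times the function integrates to zero, and the product rule leaves the factor
  \<open>\<i> * of_real (\<xi> \<bullet> b)\<close>. Repeated derivatives along a single basis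
  vector are all that the decay estimate uses.\<close>

lemma fourier_iter_deriv_replicate:
  assumes f: "f \<in> schwartz" and b: "b \<in> Basis"
  shows "fourier (iter_deriv f (replicate k b)) \<xi> = (\<i> * of_real (\<xi> \<bullet> b)) ^ k * fourier f \<xi>"
proof (induction k)
  case (Suc k)
  let ?g = "iter_deriv f (replicate k b)" and ?e = "\<lambda>x. exp (- \<i> * of_real (x \<bullet> \<xi>))"
  let ?g' = "iter_deriv f (replicate (Suc k) b)"
  let ?D = "\<lambda>x. ?e x * ?g' x + - \<i> * of_real (b \<bullet> \<xi>) * ?e x * ?g x"
  have g: "?g \<in> schwartz" and g': "?g' \<in> schwartz"
    by (intro schwartz_iter_deriv f; use b in auto)+
  note int = integrable_exp_mult[OF schwartz_integrable[OF g], of \<xi>]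
    integrable_exp_mult[OF schwartz_integrable[OF g'], of \<xi>]
  have int2: "integrable lborel (\<lambda>x. - \<i> * of_real (b \<bullet> \<xi>) * ?e x * ?g x)"
    using integrable_mult_right[OF int(1), of "- \<i> * of_real (b \<bullet> \<xi>)"] by (simp add: mult.assoc)
  have e: "(?e has_derivative (\<lambda>v. - \<i> * of_real (v \<bullet> \<xi>) * ?e x)) (at x)" for x
    by (rule has_derivative_compose[OF _ DERIV_exp[THEN has_field_derivative_imp_has_derivative],
          THEN has_derivative_eq_rhs])
       (auto intro!: derivative_eq_intros)
  have "(LINT x|lborel. ?D x) = 0"
  proof (rule integral_directional_derivative_eq_0)
    show "((\<lambda>x. ?e x * ?g x) has_derivative
        (\<lambda>v. ?e x * frechet_derivative ?g (at x) v + - \<i> * of_real (v \<bullet> \<xi>) * ?e x * ?g x)) (at x)" for x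
      using schwartz_differentiable[OF g, of x] unfolding frechet_derivative_works
      by (rule has_derivative_mult[OF e, THEN has_derivative_eq_rhs]) (auto simp: algebra_simps)
    show "continuous_on UNIV ?D"
      by (intro continuous_intros schwartz_continuous_on g g')
    show "integrable lborel ?D"
      using int(2) int2 by (rule Bochner_Integration.integrable_add)
  qed (use int in auto)
  moreover have "(LINT x|lborel. ?D x) = fourier ?g' \<xi> - \<i> * of_real (\<xi> \<bullet> b) * fourier ?g \<xi>"
    unfolding fourier_def by (subst Bochner_Integration.integral_add[OF int(2) int2])
      (simp add: mult.assoc inner_commute del: iter_deriv.simps replicate.simps)
  ultimately show ?case using Suc by (simp del: iter_deriv.simps replicate.simps)
qed simp

lemma fourier_decay:
  fixes f :: "'a::euclidean_space \<Rightarrow> complex"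
  assumes f: "f \<in> schwartz"
  obtains C where "0 \<le> C" "\<And>\<xi>. cmod (fourier f \<xi>) \<le> C * decay \<xi>"
proof -
  let ?m = "2 * DIM('a)"
  define B where "B b = (LINT x|lborel. cmod (iter_deriv f (replicate ?m b) x))" for b :: 'a
  define A where "A = (LINT x|lborel. cmod (f x))"
  have coord: "\<bar>\<xi> \<bullet> b\<bar> ^ ?m * cmod (fourier f \<xi>) \<le> B b" if "b \<in> Basis" for \<xi> b
  proof -
    have "\<bar>\<xi> \<bullet> b\<bar> ^ ?m * cmod (fourier f \<xi>) = cmod (fourier (iter_deriv f (replicate ?m b)) \<xi>)"
      by (simp add: fourier_iter_deriv_replicate[OF f that] norm_mult norm_power)
    then show ?thesis using cmod_fourier_le unfolding B_def by metis
  qed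
  have "norm \<xi> ^ ?m * cmod (fourier f \<xi>) \<le> real DIM('a) ^ ?m * (\<Sum>b\<in>Basis. B b)" for \<xi>
  proof -
    \<comment> \<open>The largest coordinate bounds the norm up to the factor
      \<open>DIM('a)\<close>, so pure powers of coordinates suffice and mixed derivatives can be
      avoided.\<close>
    obtain c :: 'a where c: "c \<in> Basis" "\<And>b. b \<in> Basis \<Longrightarrow> \<bar>\<xi> \<bullet> b\<bar> \<le> \<bar>\<xi> \<bullet> c\<bar>"
      using Max_in[of "(\<lambda>b. \<bar>\<xi> \<bullet> b\<bar>) ` Basis"] Max_ge[of "(\<lambda>b. \<bar>\<xi> \<bullet> b\<bar>) ` Basis"] by fastforce
    have "norm \<xi> \<le> (\<Sum>b\<in>(Basis::'a set). \<bar>\<xi> \<bullet> b\<bar>)" by (rule norm_le_l1)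
    also have "\<dots> \<le> DIM('a) * \<bar>\<xi> \<bullet> c\<bar>" using c(2) by (intro sum_bounded_above) simp
    finally have "norm \<xi> ^ ?m \<le> real DIM('a) ^ ?m * \<bar>\<xi> \<bullet> c\<bar> ^ ?m"
      by (metis norm_ge_zero power_mono power_mult_distrib)
    then have "norm \<xi> ^ ?m * cmod (fourier f \<xi>) \<le> real DIM('a) ^ ?m * (\<bar>\<xi> \<bullet> c\<bar> ^ ?m * cmod (fourier f \<xi>))"
      by (metis mult.assoc mult_right_mono norm_ge_zero)
    also have "\<dots> \<le> real DIM('a) ^ ?m * (\<Sum>b\<in>Basis. B b)"
      using coord[OF c(1), of \<xi>] member_le_sum[of c Basis B] c(1)
      by (intro mult_left_mono) (auto simp: B_def)
    finally show ?thesis .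
  qed
  note bd = decay_bound[of "fourier f", OF _ this, of A]
  have "0 \<le> A" "0 \<le> (\<Sum>b\<in>(Basis::'a set). B b)" by (auto simp: A_def B_def intro!: sum_nonneg)
  then show ?thesis
    using bd cmod_fourier_le[of f]
    by (intro that[of "2 ^ DIM('a) * (A + real DIM('a) ^ ?m * (\<Sum>b\<in>Basis. B b))"])
       (auto simp: A_def)
qed

subsection \<open>Fourier inversion and Plancherel\<close>

lemma
  fixes f :: "'a::euclidean_space \<Rightarrow> real \<Rightarrow> 'b::{real_normed_field, banach, second_countable_topology}"
  assumes f: "\<And>b. b \<in> Basis \<Longrightarrow> integrable lborel (f b)"
  shows integrable_lborel_prod: "integrable lborel (\<lambda>x. \<Prod>b\<in>Basis. f b (x \<bullet> b))"
    and integral_lborel_prod: "(LINT x|lborel. (\<Prod>b\<in>Basis. f b (x \<bullet> b))) = (\<Prod>b\<in>Basis. LINT t|lborel. f b t)"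
proof -
  interpret product_sigma_finite "\<lambda>_::'a. lborel :: real measure" ..
  have [measurable]: "f b \<in> borel_measurable borel" if "b \<in> Basis" for b
    using f[OF that] by auto
  have eq: "(\<Prod>b\<in>Basis. f b ((\<Sum>c\<in>Basis. x c *\<^sub>R c) \<bullet> b)) = (\<Prod>b\<in>Basis. f b (x b))" for x
    by (intro prod.cong) auto
  show "integrable lborel (\<lambda>x. \<Prod>b\<in>Basis. f b (x \<bullet> b))"
    by (subst lborel_eq, subst integrable_distr_eq) (simp_all add: eq product_integrable_prod f)
  show "(LINT x|lborel. (\<Prod>b\<in>Basis. f b (x \<bullet> b))) = (\<Prod>b\<in>Basis. LINT t|lborel. f b t)"
    by (subst lborel_eq, subst integral_distr) (simp_all add: eq product_integral_prod f)
qed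

text \<open>The variance is normalized so that this is an eigenfunction of \<open>fourier\<close>,
  with eigenvalue \<open>sqrt (2 * pi) ^ DIM('a)\<close>.\<close>

definition gauss :: "'a::euclidean_space \<Rightarrow> real" where
  "gauss x = exp (- (norm x)\<^sup>2 / 2)"

lemma gauss_pos: "0 < gauss x" by (simp add: gauss_def)

lemma gauss_le_1: "gauss x \<le> 1" by (simp add: gauss_def)

lemma gauss_measurable [measurable]: "gauss \<in> borel_measurable borel"
  unfolding gauss_def by measurable

lemma gauss_prod: "gauss (x::'a::euclidean_space) = (\<Prod>b\<in>Basis. gauss (x \<bullet> b))"
proof -
  have "(norm x)\<^sup>2 = (\<Sum>b\<in>Basis. (x \<bullet> b)\<^sup>2)"
    unfolding power2_norm_eq_inner by (subst euclidean_inner) (simp add: power2_eq_square)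
  then show ?thesis
    by (simp add: gauss_def exp_sum[symmetric] sum_negf sum_divide_distrib)
qed

text \<open>In one dimension the transform is read off from the characteristic function of the
  standard normal distribution, taken at \<open>- s\<close> because of the sign in the exponent of
  \<open>fourier\<close>.\<close>

lemma
  fixes s :: real
  shows integrable_gauss_real: "integrable lborel (gauss :: real \<Rightarrow> real)"
    and fourier_gauss_real: "fourier (\<lambda>x. complex_of_real (gauss x)) s = of_real (sqrt (2 * pi) * gauss s)"
proof -
  have eq: "gauss x = sqrt (2 * pi) * std_normal_density x" for x :: real
    by (simp add: gauss_def std_normal_density_def)
  show "integrable lborel (gauss :: real \<Rightarrow> real)"
    using integrable_mult_right[of "sqrt (2 * pi)" lborel std_normal_density] integrable_normal_density[of 1 0]
    by (simp add: eq[abs_def])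
  have "fourier (\<lambda>x. complex_of_real (gauss x)) s
      = of_real (sqrt (2 * pi)) * (LINT x|lborel. std_normal_density x *\<^sub>R iexp (- s * x))"
    unfolding fourier_def
    by (subst integral_mult_right_zero[symmetric])
       (simp add: eq scaleR_conv_of_real algebra_simps)
  also have "(LINT x|lborel. std_normal_density x *\<^sub>R iexp (- s * x)) = char std_normal_distribution (- s)"
    by (simp add: char_def integral_density)
  also have "\<dots> = of_real (gauss s)"
    by (simp add: char_std_normal_distribution gauss_def)
  finally show "fourier (\<lambda>x. complex_of_real (gauss x)) s = of_real (sqrt (2 * pi) * gauss s)"
    by simp
qed

lemma integrable_gauss: "integrable lborel (gauss :: 'a::euclidean_space \<Rightarrow> real)"
  using integrable_lborel_prod[of "\<lambda>_::'a. gauss :: real \<Rightarrow> real"] integrable_gauss_real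
  by (simp add: gauss_prod[symmetric])

lemma fourier_gauss:
  fixes w :: "'a::euclidean_space"
  shows "fourier (\<lambda>x. complex_of_real (gauss x)) w = of_real (sqrt (2 * pi) ^ DIM('a) * gauss w)"
proof -
  let ?h = "\<lambda>b t. exp (- \<i> * of_real (t * (w \<bullet> b))) * complex_of_real (gauss (t::real))"
  have "exp (- \<i> * of_real (x \<bullet> w)) * complex_of_real (gauss x) = (\<Prod>b\<in>Basis. ?h b (x \<bullet> b))" for x
    by (subst gauss_prod, subst euclidean_inner)
       (simp add: prod.distrib exp_sum[symmetric] sum_distrib_left sum_negf)
  then have "fourier (\<lambda>x. complex_of_real (gauss x)) w = (LINT x|lborel. (\<Prod>b\<in>Basis. ?h b (x \<bullet> b)))"
    by (simp add: fourier_def)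
  also have "\<dots> = (\<Prod>b\<in>Basis. LINT t|lborel. ?h b t)"
  proof (rule integral_lborel_prod)
    show "integrable lborel (?h b)" for b
      using integrable_exp_mult[OF integrable_of_real[OF integrable_gauss_real], of "w \<bullet> b"] by simp
  qed
  also have "\<dots> = (\<Prod>b\<in>(Basis :: 'a set). of_real (sqrt (2 * pi) * gauss (w \<bullet> b)))"
    using fourier_gauss_real by (simp add: fourier_def)
  also have "\<dots> = of_real (sqrt (2 * pi) ^ DIM('a) * gauss w)"
    by (subst (2) gauss_prod) (simp add: prod.distrib)
  finally show ?thesis .
qed

lemma integral_gauss: "(LINT x|lborel. gauss (x::'a::euclidean_space)) = sqrt (2 * pi) ^ DIM('a)"
proof -
  have "complex_of_real (LINT x|lborel. gauss (x::'a)) = of_real (sqrt (2 * pi) ^ DIM('a))"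
    using fourier_gauss[of "0::'a"] by (simp add: fourier_def gauss_def)
  then show ?thesis by (simp only: of_real_eq_iff)
qed

lemma fourier_measurable [measurable]:
  assumes [measurable]: "g \<in> borel_measurable borel"
  shows "fourier g \<in> borel_measurable borel"
  unfolding fourier_def by measurable

text \<open>Fubini with a symmetric kernel. Moving the transform from one factor to the other is the
  engine of both inversion and Plancherel: the second factor is a damped exponential in the former
  and \<open>cnj (fourier g)\<close> in the latter.\<close>

lemma integral_fourier_mult:
  fixes g h :: "'a::euclidean_space \<Rightarrow> complex"
  assumes g: "integrable lborel g" and h: "integrable lborel h"
  shows "(LINT x|lborel. fourier g x * h x) = (LINT x|lborel. g x * fourier h x)"
proof -
  have [measurable]: "g \<in> borel_measurable borel" "h \<in> borel_measurable borel"
    using g h by auto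
  let ?k = "\<lambda>x y. exp (- \<i> * of_real (y \<bullet> x)) * g y * h x"
  have int: "integrable (lborel \<Otimes>\<^sub>M lborel) (\<lambda>(x, y). ?k x y)"
  proof (rule lborel_pair.Fubini_integrable)
    show "integrable lborel (\<lambda>x. LINT y|lborel. norm (case (x, y) of (x, y) \<Rightarrow> ?k x y))"
      using h by (simp add: norm_mult)
    show "AE x in lborel. integrable lborel (\<lambda>y. case (x, y) of (x, y) \<Rightarrow> ?k x y)"
      using integrable_exp_mult[OF g] by simp
  qed measurable
  have "(LINT x|lborel. fourier g x * h x) = (LINT x|lborel. LINT y|lborel. ?k x y)"
    by (simp add: fourier_def)
  also have "\<dots> = (LINT y|lborel. LINT x|lborel. ?k x y)"
    by (rule lborel_pair.Fubini_integral[OF int, symmetric])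
  also have "\<dots> = (LINT y|lborel. g y * (LINT x|lborel. exp (- \<i> * of_real (x \<bullet> y)) * h x))"
    by (subst integral_mult_right_zero[symmetric]) (simp add: inner_commute mult_ac)
  finally show ?thesis by (simp add: fourier_def)
qed

text \<open>Damping \<open>fourier g\<close> by \<open>gauss (\<epsilon> \<eta>)\<close> turns the inversion integral into the average of
  \<open>g (- x + \<epsilon> z)\<close> against the Gaussian \<open>gauss z\<close>; then let \<open>\<epsilon>\<close> tend to 0.\<close>

lemma fourier_inversion:
  fixes g :: "'a::euclidean_space \<Rightarrow> complex"
  assumes cont: "continuous_on UNIV g" and bound: "\<And>x. cmod (g x) \<le> B"
    and g: "integrable lborel g" and Fg: "integrable lborel (fourier g)"
  shows "fourier (fourier g) x = of_real ((2 * pi) ^ DIM('a)) * g (- x)"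
proof -
  let ?c = "sqrt (2 * pi) ^ DIM('a)"
  have [measurable]: "g \<in> borel_measurable borel"
    using cont by (rule borel_measurable_continuous_onI)
  have [measurable]: "fourier g \<in> borel_measurable borel" by measurable
  define I where "I \<epsilon> = (LINT \<eta>|lborel. fourier g \<eta> * (exp (- \<i> * of_real (\<eta> \<bullet> x)) * of_real (gauss (\<epsilon> *\<^sub>R \<eta>))))"
    for \<epsilon> :: real
  have gauss_int: "integrable lborel (\<lambda>\<eta>::'a. gauss (\<epsilon> *\<^sub>R \<eta>))" if "\<epsilon> > 0" for \<epsilon>
    using integrable_lborel_affine[OF integrable_gauss, of \<epsilon> 0] that by simp
  have I_eq: "I \<epsilon> = ?c * (LINT z|lborel. g (- x + \<epsilon> *\<^sub>R z) * of_real (gauss z))" if "\<epsilon> > 0" for \<epsilon>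
  proof -
    let ?h = "\<lambda>\<eta>. exp (- \<i> * of_real (\<eta> \<bullet> x)) * of_real (gauss (\<epsilon> *\<^sub>R \<eta>))"
    have h: "integrable lborel ?h"
      by (rule integrable_exp_mult) (use gauss_int[OF that] in \<open>simp add: integrable_of_real\<close>)
    \<comment> \<open>At the point \<open>- x + \<epsilon> *\<^sub>R z\<close> the modulation in
      \<open>?h\<close> cancels the shift by \<open>- x\<close>, and only the transform of a dilated
      Gaussian remains. Its denominator is the Jacobian of the substitution made below.\<close>
    have Fh: "fourier ?h (- x + \<epsilon> *\<^sub>R z) = of_real (?c * gauss z / \<epsilon> ^ DIM('a))" for z
    proof -
      have "of_real (?c * gauss z) = (LINT \<eta>|lborel. exp (- \<i> * of_real (\<eta> \<bullet> z)) * complex_of_real (gauss \<eta>))"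
        using fourier_gauss[of z] by (simp add: fourier_def)
      also have "\<dots> = \<epsilon> ^ DIM('a) *\<^sub>R (LINT \<eta>|lborel. exp (- \<i> * of_real ((0 + \<epsilon> *\<^sub>R \<eta>) \<bullet> z)) * complex_of_real (gauss (0 + \<epsilon> *\<^sub>R \<eta>)))"
        using that by (subst integral_lborel_affine[of _ \<epsilon> 0]) simp_all
      also have "\<dots> = \<epsilon> ^ DIM('a) *\<^sub>R fourier ?h (- x + \<epsilon> *\<^sub>R z)"
        unfolding fourier_def mult.assoc[symmetric] exp_add[symmetric]
        by (simp add: algebra_simps inner_add_right)
      finally show ?thesis using that by (simp add: scaleR_conv_of_real field_simps)
    qed
    have "I \<epsilon> = (LINT y|lborel. g y * fourier ?h y)"
      unfolding I_def by (rule integral_fourier_mult[OF g h])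
    also have "\<dots> = \<epsilon> ^ DIM('a) *\<^sub>R (LINT z|lborel. g (- x + \<epsilon> *\<^sub>R z) * fourier ?h (- x + \<epsilon> *\<^sub>R z))"
      using that by (subst integral_lborel_affine[of _ \<epsilon> "- x"]) simp_all
    also have "\<dots> = \<epsilon> ^ DIM('a) *\<^sub>R (LINT z|lborel. of_real (?c / \<epsilon> ^ DIM('a)) * (g (- x + \<epsilon> *\<^sub>R z) * of_real (gauss z)))"
      by (simp only: Fh) (simp add: mult_ac)
    also have "\<dots> = ?c * (LINT z|lborel. g (- x + \<epsilon> *\<^sub>R z) * of_real (gauss z))"
      using that by (subst integral_mult_right_zero) (simp add: scaleR_conv_of_real)
    finally show ?thesis .
  qed
  \<comment> \<open>Dominated convergence runs along a sequence, so \<open>\<epsilon>\<close> is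
    discretized.\<close>
  define e where "e n = 1 / real (Suc n)" for n
  have e: "e n > 0" "e \<longlonglongrightarrow> 0" for n
    unfolding e_def using LIMSEQ_inverse_real_of_nat by (simp_all add: inverse_eq_divide)
  have "(\<lambda>n. I (e n)) \<longlonglongrightarrow> (LINT \<eta>|lborel. fourier g \<eta> * (exp (- \<i> * of_real (\<eta> \<bullet> x)) * of_real (gauss (0 *\<^sub>R \<eta>))))"
    unfolding I_def
  proof (rule integral_dominated_convergence[where w = "\<lambda>\<eta>. cmod (fourier g \<eta>)"])
    show "AE \<eta> in lborel. (\<lambda>n. fourier g \<eta> * (exp (- \<i> * of_real (\<eta> \<bullet> x)) * of_real (gauss (e n *\<^sub>R \<eta>))))
        \<longlonglongrightarrow> fourier g \<eta> * (exp (- \<i> * of_real (\<eta> \<bullet> x)) * of_real (gauss (0 *\<^sub>R \<eta>)))"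
      unfolding gauss_def by (intro AE_I2 tendsto_intros e) auto
    show "AE \<eta> in lborel. cmod (fourier g \<eta> * (exp (- \<i> * of_real (\<eta> \<bullet> x)) * of_real (gauss (e n *\<^sub>R \<eta>))))
        \<le> cmod (fourier g \<eta>)" for n
      by (intro AE_I2)
        (simp add: norm_mult abs_of_pos[OF gauss_pos] mult_left_le[OF gauss_le_1 norm_ge_zero])
  qed (use Fg in \<open>auto simp: gauss_def\<close>)
  then have lim1: "(\<lambda>n. I (e n)) \<longlonglongrightarrow> fourier (fourier g) x"
    by (simp add: fourier_def gauss_def mult.commute)
  have "(\<lambda>n. LINT z|lborel. g (- x + e n *\<^sub>R z) * of_real (gauss z))
      \<longlonglongrightarrow> (LINT z|lborel. g (- x) * complex_of_real (gauss (z::'a)))"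
  proof (rule integral_dominated_convergence[where w = "\<lambda>z. B * gauss z"])
    show "AE z in lborel. (\<lambda>n. g (- x + e n *\<^sub>R z) * of_real (gauss z)) \<longlonglongrightarrow> g (- x) * of_real (gauss z)"
    proof (intro AE_I2 tendsto_mult tendsto_const)
      fix z
      have "(\<lambda>n. - x + e n *\<^sub>R z) \<longlonglongrightarrow> - x + 0 *\<^sub>R z" by (intro tendsto_intros e)
      then show "(\<lambda>n. g (- x + e n *\<^sub>R z)) \<longlonglongrightarrow> g (- x)"
        using continuous_on_tendsto_compose[OF cont] by simp
    qed
    show "AE z in lborel. cmod (g (- x + e n *\<^sub>R z) * of_real (gauss z)) \<le> B * gauss z" for n
      using bound by (intro AE_I2) (simp add: norm_mult gauss_pos less_imp_le mult_right_mono)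
  qed (use integrable_gauss in auto)
  also have "(LINT z|lborel. g (- x) * complex_of_real (gauss (z::'a))) = g (- x) * of_real ?c"
    by (simp add: integral_gauss)
  finally have "(\<lambda>n. I (e n)) \<longlonglongrightarrow> of_real ?c * (g (- x) * of_real ?c)"
    using e(1) by (simp add: I_eq tendsto_mult_left)
  with lim1 have "fourier (fourier g) x = of_real ?c * (g (- x) * of_real ?c)"
    by (rule LIMSEQ_unique)
  \<comment> \<open>One factor \<open>?c\<close> is the Gaussian eigenvalue, the other the total
    mass of the Gaussian.\<close>
  also have "\<dots> = of_real (?c * ?c) * g (- x)" by (simp add: mult_ac)
  also have "?c * ?c = (2 * pi) ^ DIM('a)"
    by (subst power_mult_distrib[symmetric]) simp
  finally show ?thesis .
qed

lemma integrable_norm_square: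
  fixes g :: "'a::euclidean_space \<Rightarrow> complex"
  assumes g: "integrable lborel g" and bound: "\<And>x. cmod (g x) \<le> B"
  shows "integrable lborel (\<lambda>x. (cmod (g x))\<^sup>2)"
proof (rule Bochner_Integration.integrable_bound[of _ "\<lambda>x. B * g x"])
  have "(cmod (g x))\<^sup>2 \<le> \<bar>B\<bar> * cmod (g x)" for x
    using bound[of x] by (simp add: power2_eq_square mult_right_mono)
  then show "AE x in lborel. norm ((cmod (g x))\<^sup>2) \<le> norm (B * g x)"
    by (simp add: norm_mult)
qed (use g in auto)

text \<open>Conjugation reflects the frequency and so undoes the reflection in the inversion
  formula: the transform of \<open>cnj (fourier g)\<close> is \<open>(2 * pi) ^ DIM('a)\<close>
  times \<open>cnj g\<close>. Moving the transform across the product of \<open>fourier g\<close>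
  with its conjugate then gives the identity.\<close>

lemma plancherel:
  fixes g :: "'a::euclidean_space \<Rightarrow> complex"
  assumes cont: "continuous_on UNIV g" and bound: "\<And>x. cmod (g x) \<le> B"
    and g: "integrable lborel g" and Fg: "integrable lborel (fourier g)"
  shows "(\<integral>\<^sup>+\<eta>. ennreal ((cmod (fourier g \<eta>))\<^sup>2) \<partial>lborel)
    = ennreal ((2 * pi) ^ DIM('a)) * (\<integral>\<^sup>+y. ennreal ((cmod (g y))\<^sup>2) \<partial>lborel)"
proof -
  let ?h = "\<lambda>\<eta>. cnj (fourier g \<eta>)"
  have Fh: "fourier ?h y = of_real ((2 * pi) ^ DIM('a)) * cnj (g y)" for y
  proof -
    have "fourier ?h y = cnj (fourier (fourier g) (- y))"
      by (simp add: fourier_def exp_cnj flip: Bochner_Integration.integral_cnj)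
    then show ?thesis
      by (simp add: fourier_inversion[OF cont bound g Fg])
  qed
  have "complex_of_real (LINT \<eta>|lborel. (cmod (fourier g \<eta>))\<^sup>2) = (LINT \<eta>|lborel. fourier g \<eta> * ?h \<eta>)"
    by (simp only: complex_norm_square flip: integral_complex_of_real)
  also have "\<dots> = (LINT y|lborel. g y * fourier ?h y)"
    using Fg by (intro integral_fourier_mult g) simp
  also have "\<dots> = (LINT y|lborel. of_real ((2 * pi) ^ DIM('a) * (cmod (g y))\<^sup>2))"
    by (intro Bochner_Integration.integral_cong refl)
       (simp add: Fh complex_norm_square mult_ac del: of_real_power)
  also have "\<dots> = of_real ((2 * pi) ^ DIM('a) * (LINT y|lborel. (cmod (g y))\<^sup>2))"
    by (simp only: integral_complex_of_real integral_mult_right_zero)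
  finally have "(LINT \<eta>|lborel. (cmod (fourier g \<eta>))\<^sup>2) = (2 * pi) ^ DIM('a) * (LINT y|lborel. (cmod (g y))\<^sup>2)"
    by (simp only: of_real_eq_iff)
  then show ?thesis
    using integrable_norm_square[OF g bound] integrable_norm_square[OF Fg cmod_fourier_le]
    by (simp add: nn_integral_eq_integral ennreal_mult)
qed

subsection \<open>Polar coordinates\<close>

lemma id_measurable_sphere_measure: "(\<lambda>x. x) \<in> sphere_measure \<rightarrow>\<^sub>M borel"
  by (subst measurable_cong_sets[OF sets_sphere_measure refl]) (rule measurable_restrict_space1, simp)

lemma nn_integral_sphere_measure:
  fixes h :: "'a::euclidean_space \<Rightarrow> ennreal"
  assumes [measurable]: "h \<in> borel_measurable borel"
  shows "(\<integral>\<^sup>+\<theta>. h \<theta> \<partial>sphere_measure)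
    = of_nat DIM('a) * (\<integral>\<^sup>+x. h (sgn x) * indicator (cball 0 1 - {0}) x \<partial>lborel)"
proof -
  have m: "(sgn :: 'a \<Rightarrow> 'a) \<in> restrict_space lborel (cball 0 1 - {0}) \<rightarrow>\<^sub>M restrict_space borel (sphere 0 1)"
    by (intro measurable_restrict_space2 measurable_restrict_space1)
       (auto simp: space_restrict_space norm_sgn)
  have h: "h \<in> borel_measurable (restrict_space borel (sphere 0 1))"
    by (rule measurable_restrict_space1) simp
  show ?thesis
    unfolding sphere_measure_def
    using m h by (simp add: nn_integral_scale_measure nn_integral_distr nn_integral_restrict_space)
qed

lemma finite_measure_sphere_measure: "finite_measure (sphere_measure :: 'a::euclidean_space measure)"
proof (rule finite_measureI)
  have "emeasure (sphere_measure :: 'a measure) (space sphere_measure)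
      = (\<integral>\<^sup>+\<theta>. 1 \<partial>(sphere_measure :: 'a measure))"
    by simp
  also have "\<dots> = of_nat DIM('a) * emeasure lborel (cball (0::'a) 1 - {0})"
    by (subst nn_integral_sphere_measure) simp_all
  also have "\<dots> \<noteq> \<infinity>"
  proof -
    have "emeasure lborel (cball (0::'a) 1 - {0}) \<le> emeasure lborel (cball (0::'a) 1)"
      by (intro emeasure_mono) auto
    also have "\<dots> < \<infinity>" by (rule emeasure_lborel_cball_finite)
    finally show ?thesis by (simp add: ennreal_mult_eq_top_iff)
  qed
  finally show "emeasure (sphere_measure :: 'a measure) (space sphere_measure) \<noteq> \<infinity>" .
qed

text \<open>Packing the half-line and the Jacobian into one measure makes polar coordinates an image
  of a product measure, so that Fubini and change of variables apply as they stand.\<close>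

definition radial_measure :: "nat \<Rightarrow> real measure" where
  "radial_measure k = density lborel (\<lambda>z. ennreal (indicator {0..} z * z ^ k))"

lemma sets_radial_measure [measurable_cong, simp]: "sets (radial_measure k) = sets borel"
  by (simp add: radial_measure_def)

lemma sigma_finite_radial_measure: "sigma_finite_measure (radial_measure k)"
  unfolding radial_measure_def by (subst sigma_finite_measure.sigma_finite_iff_density_finite[OF sigma_finite_lborel]) auto

lemma nn_integral_radial_measure:
  assumes [measurable]: "h \<in> borel_measurable borel"
  shows "(\<integral>\<^sup>+z. h z \<partial>radial_measure k) = (\<integral>\<^sup>+z. ennreal (indicator {0..} z * z ^ k) * h z \<partial>lborel)"
  unfolding radial_measure_def by (simp add: nn_integral_density)

text \<open>An antiderivative is \<open>- inverse (real d * t ^ d)\<close>. The resulting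
  \<open>1 / d\<close> cancels the factor \<open>DIM('a)\<close> that normalizes
  \<open>sphere_measure\<close>.\<close>

lemma nn_integral_inverse_power_atLeast:
  assumes "0 < a" "0 < d"
  shows "(\<integral>\<^sup>+t. ennreal (indicator {a..} t * inverse (t ^ Suc d)) \<partial>lborel) = ennreal (inverse (real d * a ^ d))"
proof -
  have "(\<integral>\<^sup>+t. ennreal (inverse (t ^ Suc d)) * indicator {a..} t \<partial>lborel)
      = ennreal (0 - - inverse (real d * a ^ d))"
  proof (rule nn_integral_FTC_atLeast)
    fix t assume "a \<le> t"
    then have t: "0 < t" using assms by simp
    have "((\<lambda>t. inverse (t ^ d)) has_real_derivative - (inverse (t ^ d) * (real d * t ^ (d - 1)) * inverse (t ^ d))) (at t)"
      using t by (auto intro!: derivative_eq_intros)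
    note deriv = DERIV_cmult[OF this, of "- inverse (real d)"]
    have eq: "- inverse (real d) * - (inverse (t ^ d) * (real d * t ^ (d - 1)) * inverse (t ^ d)) = inverse (t ^ Suc d)"
    proof -
      have "t ^ d = t * t ^ (d - 1)" using assms by (simp add: power_eq_if)
      then show ?thesis using t assms by (simp add: field_simps)
    qed
    show "((\<lambda>t. - inverse (real d * t ^ d)) has_real_derivative inverse (t ^ Suc d)) (at t)"
      using DERIV_cong[OF deriv eq] by simp
    show "0 \<le> inverse (t ^ Suc d)" using t by simp
  next
    have "filterlim (\<lambda>t::real. real d * t ^ d) at_top at_top"
      using assms by (intro filterlim_tendsto_pos_mult_at_top[OF tendsto_const] filterlim_pow_at_top filterlim_ident) auto
    then show "((\<lambda>t. - inverse (real d * t ^ d)) \<longlongrightarrow> 0) at_top"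
      using tendsto_minus[OF tendsto_inverse_0_at_top] by fastforce
  qed simp
  moreover have "ennreal (indicator {a..} t * x) = ennreal x * indicator {a..} t" for t x :: real
    by (simp add: indicator_def)
  ultimately show ?thesis by simp
qed

text \<open>Written as an integral over the punctured unit ball, the left-hand side becomes the integral
  of \<open>k y\<close> against \<open>DIM('a) * norm y ^ DIM('a) * (\<integral>t\<ge>norm y. t ^ -(DIM('a) + 1) dt) = 1\<close> after
  the substitutions \<open>z = t * norm x\<close> and \<open>y = t x\<close>.\<close>

lemma nn_integral_polar:
  fixes k :: "'a::euclidean_space \<Rightarrow> ennreal"
  assumes [measurable]: "k \<in> borel_measurable borel"
  shows "(\<integral>\<^sup>+\<theta>. \<integral>\<^sup>+z. k (z *\<^sub>R \<theta>) \<partial>radial_measure (DIM('a) - 1) \<partial>sphere_measure) = (\<integral>\<^sup>+y. k y \<partial>lborel)"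
proof -
  let ?d = "DIM('a)"
  define C where "C = cball (0::'a) 1 - {0}"
  have [measurable]: "C \<in> sets borel" by (simp add: C_def)
  have d: "0 < ?d" by simp
  define r where "r z = (indicator {0..} z * z ^ (?d - 1) :: real)" for z :: real
  have [measurable]: "r \<in> borel_measurable borel" unfolding r_def by measurable
  have r_nonneg: "0 \<le> r z" for z by (simp add: r_def indicator_def)
  \<comment> \<open>The extra factor \<open>c\<close> is the Jacobian of the one-dimensional
    substitution; together with the degree \<open>?d - 1\<close> of \<open>r\<close> it yields the
    full power \<open>c ^ ?d\<close>.\<close>
  have r_scale: "c * r (c * t) = c ^ ?d * r t" if "0 < c" for c t
    using that by (auto simp: r_def indicator_def power_mult_distrib zero_le_mult_iff power_eq_if[of c ?d])
  have h: "(\<integral>\<^sup>+z. k (z *\<^sub>R sgn x) \<partial>radial_measure (?d - 1))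
      = (\<integral>\<^sup>+t. ennreal (norm x ^ ?d * r t) * k (t *\<^sub>R x) \<partial>lborel)" if "x \<noteq> 0" for x
  proof -
    have "(\<integral>\<^sup>+z. k (z *\<^sub>R sgn x) \<partial>radial_measure (?d - 1)) = (\<integral>\<^sup>+z. ennreal (r z) * k (z *\<^sub>R sgn x) \<partial>lborel)"
      by (simp add: nn_integral_radial_measure r_def)
    also have "\<dots> = ennreal (norm x) * (\<integral>\<^sup>+t. ennreal (r (norm x * t)) * k ((norm x * t) *\<^sub>R sgn x) \<partial>lborel)"
      using that by (subst nn_integral_lborel_affine[where c="norm x" and t=0]) simp_all
    also have "\<dots> = (\<integral>\<^sup>+t. ennreal (norm x) * (ennreal (r (norm x * t)) * k ((norm x * t) *\<^sub>R sgn x)) \<partial>lborel)"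
      by (simp add: nn_integral_cmult)
    also have "\<dots> = (\<integral>\<^sup>+t. ennreal (norm x ^ ?d * r t) * k (t *\<^sub>R x) \<partial>lborel)"
    proof (rule nn_integral_cong)
      fix t
      have "(norm x * t) *\<^sub>R sgn x = t *\<^sub>R x" using that by (simp add: sgn_div_norm)
      then show "ennreal (norm x) * (ennreal (r (norm x * t)) * k ((norm x * t) *\<^sub>R sgn x))
          = ennreal (norm x ^ ?d * r t) * k (t *\<^sub>R x)"
        using that r_scale[of "norm x" t] r_nonneg by (simp add: mult.assoc[symmetric] flip: ennreal_mult)
    qed
    finally show ?thesis .
  qed
  \<comment> \<open>This is the integrand after \<open>y = t x\<close>: the ball condition becomes
    \<open>norm y \<le> t\<close>, and \<open>norm x ^ ?d * t ^ (?d - 1)\<close> times the Jacobian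
    \<open>t ^ (- ?d)\<close> becomes \<open>norm y ^ ?d / t ^ (?d + 1)\<close>.\<close>
  let ?w = "\<lambda>t y. ennreal (if norm y \<le> t \<and> y \<noteq> 0 then inverse (t ^ Suc ?d) * norm y ^ ?d else 0) * k y"
  have scale: "(\<integral>\<^sup>+x. ennreal (norm x ^ ?d * r t) * k (t *\<^sub>R x) * indicator C x \<partial>lborel)
      = (\<integral>\<^sup>+y. ?w t y \<partial>lborel)" if "t \<noteq> 0" for t
  proof (cases "0 < t")
    case True
    have eq: "t ^ ?d * (if norm (t *\<^sub>R x) \<le> t \<and> t *\<^sub>R x \<noteq> 0 then inverse (t ^ Suc ?d) * norm (t *\<^sub>R x) ^ ?d else 0)
        = norm x ^ ?d * r t * indicator C x" for x :: 'a
      using True power_minus_mult[OF d, of t] by (auto simp: r_def C_def indicator_def power_mult_distrib field_simps)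
    have "(\<integral>\<^sup>+y. ?w t y \<partial>lborel) = ennreal (t ^ ?d) * (\<integral>\<^sup>+x. ?w t (t *\<^sub>R x) \<partial>lborel)"
    proof -
      have "?w t \<in> borel_measurable borel" by measurable
      from nn_integral_lborel_affine[OF this that, of 0] show ?thesis
        using True by (simp only: abs_of_pos add_0)
    qed
    also have "\<dots> = (\<integral>\<^sup>+x. ennreal (t ^ ?d) * ?w t (t *\<^sub>R x) \<partial>lborel)"
      by (simp add: nn_integral_cmult)
    also have "\<dots> = (\<integral>\<^sup>+x. ennreal (norm x ^ ?d * r t) * k (t *\<^sub>R x) * indicator C x \<partial>lborel)"
    proof (rule nn_integral_cong)
      fix x :: 'a
      have "ennreal (t ^ ?d) * ?w t (t *\<^sub>R x) = ennreal (norm x ^ ?d * r t * indicator C x) * k (t *\<^sub>R x)"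
        using True eq[of x] by (simp add: mult.assoc[symmetric] flip: ennreal_mult')
      then show "ennreal (t ^ ?d) * ?w t (t *\<^sub>R x) = ennreal (norm x ^ ?d * r t) * k (t *\<^sub>R x) * indicator C x"
        by (simp add: indicator_def)
    qed
    finally show ?thesis ..
  next
    \<comment> \<open>For negative \<open>t\<close> both sides vanish: \<open>r t\<close> is zero,
      and no norm is at most \<open>t\<close>.\<close>
    case False
    then have r: "r t = 0" and "\<not> (norm y \<le> t \<and> y \<noteq> 0)" for y :: 'a
      using that order.trans[OF norm_ge_zero, of y t] by (auto simp: r_def)
    then have "?w t y = 0" for y by (simp only: if_False) simp
    then show ?thesis by (simp only: r) simp
  qed
  have radial: "(\<integral>\<^sup>+t. ?w t y \<partial>lborel) = ennreal (inverse (real ?d)) * k y" if "y \<noteq> 0" for y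
  proof -
    have "(\<integral>\<^sup>+t. ?w t y \<partial>lborel)
        = (\<integral>\<^sup>+t. ennreal (norm y ^ ?d) * k y * ennreal (indicator {norm y..} t * inverse (t ^ Suc ?d)) \<partial>lborel)"
      using that by (intro nn_integral_cong) (auto simp: indicator_def mult_ac simp flip: ennreal_mult')
    also have "\<dots> = ennreal (norm y ^ ?d) * k y * ennreal (inverse (real ?d * norm y ^ ?d))"
      using that nn_integral_inverse_power_atLeast[OF _ d, of "norm y"]
      by (subst nn_integral_cmult) simp_all
    also have "\<dots> = ennreal (norm y ^ ?d * inverse (real ?d * norm y ^ ?d)) * k y"
      by (subst ennreal_mult) (simp_all add: mult_ac)
    also have "norm y ^ ?d * inverse (real ?d * norm y ^ ?d) = inverse (real ?d)"
      using that by (simp add: field_simps)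
    finally show ?thesis .
  qed
  have "(\<integral>\<^sup>+\<theta>. \<integral>\<^sup>+z. k (z *\<^sub>R \<theta>) \<partial>radial_measure (?d - 1) \<partial>sphere_measure)
      = of_nat ?d * (\<integral>\<^sup>+x. (\<integral>\<^sup>+z. k (z *\<^sub>R sgn x) \<partial>radial_measure (?d - 1)) * indicator C x \<partial>lborel)"
    unfolding C_def by (rule nn_integral_sphere_measure)
       (intro sigma_finite_measure.borel_measurable_nn_integral[OF sigma_finite_radial_measure], measurable)
  also have "(\<integral>\<^sup>+x. (\<integral>\<^sup>+z. k (z *\<^sub>R sgn x) \<partial>radial_measure (?d - 1)) * indicator C x \<partial>lborel)
      = (\<integral>\<^sup>+x. \<integral>\<^sup>+t. ennreal (norm x ^ ?d * r t) * k (t *\<^sub>R x) * indicator C x \<partial>lborel \<partial>lborel)"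
  proof (rule nn_integral_cong)
    fix x :: 'a
    show "(\<integral>\<^sup>+z. k (z *\<^sub>R sgn x) \<partial>radial_measure (?d - 1)) * indicator C x
        = (\<integral>\<^sup>+t. ennreal (norm x ^ ?d * r t) * k (t *\<^sub>R x) * indicator C x \<partial>lborel)"
      using h[of x] by (cases "x \<in> C") (auto simp: C_def)
  qed
  also have "\<dots> = (\<integral>\<^sup>+t. \<integral>\<^sup>+x. ennreal (norm x ^ ?d * r t) * k (t *\<^sub>R x) * indicator C x \<partial>lborel \<partial>lborel)"
    by (rule lborel_pair.Fubini') measurable
  also have "\<dots> = (\<integral>\<^sup>+t. \<integral>\<^sup>+y. ?w t y \<partial>lborel \<partial>lborel)"
    by (intro nn_integral_cong_AE) (use AE_lborel_singleton[of "0::real"] in eventually_elim, rule scale)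
  also have "\<dots> = (\<integral>\<^sup>+y. \<integral>\<^sup>+t. ?w t y \<partial>lborel \<partial>lborel)"
    by (rule lborel_pair.Fubini') measurable
  also have "\<dots> = (\<integral>\<^sup>+y. ennreal (inverse (real ?d)) * k y \<partial>lborel)"
    by (intro nn_integral_cong_AE) (use AE_lborel_singleton[of "0::'a"] in eventually_elim, rule radial)
  also have "\<dots> = ennreal (inverse (real ?d)) * (\<integral>\<^sup>+y. k y \<partial>lborel)"
    by (simp add: nn_integral_cmult)
  also have "of_nat ?d * (ennreal (inverse (real ?d)) * (\<integral>\<^sup>+y. k y \<partial>lborel)) = (\<integral>\<^sup>+y. k y \<partial>lborel)"
    by (simp add: mult.assoc[symmetric] ennreal_of_nat_eq_real_of_nat flip: ennreal_mult)
  finally show ?thesis .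
qed

text \<open>The formula for nonnegative integrands is recast as an equality of measures, which also
  carries over vector-valued integrals.\<close>

lemma lborel_polar:
  "distr (sphere_measure \<Otimes>\<^sub>M radial_measure (DIM('a::euclidean_space) - 1)) borel (\<lambda>(\<theta>, z). z *\<^sub>R \<theta>) = (lborel :: 'a measure)"
proof (rule measure_eqI)
  let ?N = "radial_measure (DIM('a) - 1)" and ?T = "\<lambda>(\<theta>::'a, z::real). z *\<^sub>R \<theta>"
  interpret N: sigma_finite_measure ?N by (rule sigma_finite_radial_measure)
  have T: "?T \<in> borel_measurable (sphere_measure \<Otimes>\<^sub>M ?N)"
    unfolding split_beta'
    by (intro borel_measurable_scaleR measurable_compose[OF measurable_fst id_measurable_sphere_measure])
       simp
  fix A assume "A \<in> sets (distr (sphere_measure \<Otimes>\<^sub>M ?N) borel ?T)"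
  then have [measurable]: "A \<in> sets borel" by simp
  have "emeasure (distr (sphere_measure \<Otimes>\<^sub>M ?N) borel ?T) A
      = (\<integral>\<^sup>+p. indicator A (?T p) \<partial>(sphere_measure \<Otimes>\<^sub>M ?N))"
    using nn_integral_distr[OF T, of "indicator A"] by simp
  also have "\<dots> = (\<integral>\<^sup>+\<theta>. \<integral>\<^sup>+z. indicator A (?T (\<theta>, z)) \<partial>?N \<partial>sphere_measure)"
    by (rule N.nn_integral_fst[symmetric]) (rule measurable_compose[OF T], simp)
  also have "\<dots> = emeasure lborel A"
    using nn_integral_polar[of "indicator A"] by simp
  finally show "emeasure (distr (sphere_measure \<Otimes>\<^sub>M ?N) borel ?T) A = emeasure lborel A" .
qed simp

text \<open>The almost-everywhere statement matters in dimension one: the sphere then consists of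
  two atoms, so integrability holds along each of the two rays, and the two half-line integrals may
  be added under one integral sign.\<close>

lemma
  fixes k :: "'a::euclidean_space \<Rightarrow> 'b::{banach, second_countable_topology}"
  assumes k: "integrable lborel k"
  shows integral_polar: "(LINT \<theta>|sphere_measure. (LINT z:{0..}|lborel. z ^ (DIM('a) - 1) *\<^sub>R k (z *\<^sub>R \<theta>))) = (LINT y|lborel. k y)"
    and AE_set_integrable_polar: "AE \<theta> in sphere_measure. set_integrable lborel {0..} (\<lambda>z. z ^ (DIM('a) - 1) *\<^sub>R k (z *\<^sub>R \<theta>))"
proof -
  let ?N = "radial_measure (DIM('a) - 1)" and ?T = "\<lambda>(\<theta>::'a, z::real). z *\<^sub>R \<theta>"
  have [measurable]: "k \<in> borel_measurable borel" using k by auto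
  interpret S: finite_measure "sphere_measure :: 'a measure" by (rule finite_measure_sphere_measure)
  interpret N: sigma_finite_measure ?N by (rule sigma_finite_radial_measure)
  interpret P: pair_sigma_finite "sphere_measure :: 'a measure" ?N ..
  have T: "?T \<in> borel_measurable (sphere_measure \<Otimes>\<^sub>M ?N)"
    unfolding split_beta'
    by (intro borel_measurable_scaleR measurable_compose[OF measurable_fst id_measurable_sphere_measure])
       simp
  have int: "integrable (sphere_measure \<Otimes>\<^sub>M ?N) (\<lambda>p. k (?T p))"
    by (rule integrable_distr[OF T]) (simp only: lborel_polar k)
  have "(LINT y|lborel. k y) = (LINT p|(sphere_measure \<Otimes>\<^sub>M ?N). k (?T p))"
    by (subst lborel_polar[symmetric], subst integral_distr[OF T]) simp_all
  also have "\<dots> = (LINT \<theta>|sphere_measure. LINT z|?N. k (?T (\<theta>, z)))"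
    by (rule P.integral_fst'[OF int, symmetric])
  finally show "(LINT \<theta>|sphere_measure. (LINT z:{0..}|lborel. z ^ (DIM('a) - 1) *\<^sub>R k (z *\<^sub>R \<theta>))) = (LINT y|lborel. k y)"
    by (simp add: radial_measure_def integral_density indicator_def set_lebesgue_integral_def
        cong: if_cong)
  have "AE \<theta> in sphere_measure. integrable ?N (\<lambda>z. k (z *\<^sub>R \<theta>))"
    using P.AE_integrable_fst'[OF int] by simp
  then show "AE \<theta> in sphere_measure. set_integrable lborel {0..} (\<lambda>z. z ^ (DIM('a) - 1) *\<^sub>R k (z *\<^sub>R \<theta>))"
    by eventually_elim
       (simp add: radial_measure_def integrable_density set_integrable_def indicator_def)
qed

lemma nn_integral_radial:
  fixes h :: "real \<Rightarrow> ennreal"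
  assumes [measurable]: "h \<in> borel_measurable borel"
  shows "(\<integral>\<^sup>+y. h (norm y) \<partial>(lborel :: 'a::euclidean_space measure))
    = emeasure (sphere_measure :: 'a measure) (sphere 0 1) * (\<integral>\<^sup>+z. h z \<partial>radial_measure (DIM('a) - 1))"
proof -
  let ?N = "radial_measure (DIM('a) - 1)"
  have "(\<integral>\<^sup>+y. h (norm y) \<partial>(lborel :: 'a measure))
      = (\<integral>\<^sup>+\<theta>. \<integral>\<^sup>+z. h (norm (z *\<^sub>R (\<theta>::'a))) \<partial>?N \<partial>sphere_measure)"
    by (rule nn_integral_polar[symmetric]) simp
  also have "\<dots> = (\<integral>\<^sup>+\<theta>. \<integral>\<^sup>+z. h z \<partial>?N \<partial>(sphere_measure :: 'a measure))"
  proof (rule nn_integral_cong)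
    fix \<theta> :: 'a assume "\<theta> \<in> space sphere_measure"
    then have \<theta>: "norm \<theta> = 1" by (simp add: space_sphere_measure)
    have "(\<integral>\<^sup>+z. h (norm (z *\<^sub>R \<theta>)) \<partial>?N) = (\<integral>\<^sup>+z. ennreal (indicator {0..} z * z ^ (DIM('a) - 1)) * h (norm (z *\<^sub>R \<theta>)) \<partial>lborel)"
      by (rule nn_integral_radial_measure) simp
    also have "\<dots> = (\<integral>\<^sup>+z. ennreal (indicator {0..} z * z ^ (DIM('a) - 1)) * h z \<partial>lborel)"
      by (intro nn_integral_cong) (simp add: \<theta> indicator_def)
    also have "\<dots> = (\<integral>\<^sup>+z. h z \<partial>?N)" by (simp add: nn_integral_radial_measure)
    finally show "(\<integral>\<^sup>+z. h (norm (z *\<^sub>R \<theta>)) \<partial>?N) = (\<integral>\<^sup>+z. h z \<partial>?N)" .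
  qed
  also have "\<dots> = emeasure (sphere_measure :: 'a measure) (sphere 0 1) * (\<integral>\<^sup>+z. h z \<partial>?N)"
    by (simp add: space_sphere_measure mult.commute)
  finally show ?thesis .
qed

text \<open>If the sphere had measure zero, polar coordinates would give the whole space measure
  zero. Being neither zero nor infinite, this constant can be cancelled between the two radial
  norms.\<close>

lemma emeasure_sphere_measure_pos_finite:
  "emeasure (sphere_measure :: 'a::euclidean_space measure) (sphere 0 1) \<noteq> 0"
  "emeasure (sphere_measure :: 'a::euclidean_space measure) (sphere 0 1) \<noteq> \<infinity>"
proof -
  interpret S: finite_measure "sphere_measure :: 'a measure" by (rule finite_measure_sphere_measure)
  show "emeasure (sphere_measure :: 'a measure) (sphere 0 1) \<noteq> \<infinity>" by (simp add: S.emeasure_finite)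
  show "emeasure (sphere_measure :: 'a measure) (sphere 0 1) \<noteq> 0"
  proof
    assume "emeasure (sphere_measure :: 'a measure) (sphere 0 1) = 0"
    then have "(\<integral>\<^sup>+y. 1 \<partial>(lborel :: 'a measure)) = 0"
      by (subst nn_integral_radial) simp_all
    then show False by simp
  qed
qed

text \<open>Connects the two-term formula for \<open>CARD('m) = 1\<close> in
  \<open>radial_cone_transform\<close> with the general polar formula.\<close>

lemma sphere_measure_dim_1:
  assumes "CARD('m::finite) = 1"
  shows "(sphere_measure :: (real^'m) measure) = count_space {1, - 1}"
proof (rule measure_eqI_finite)
  obtain i :: 'm where i: "UNIV = {i}" using assms card_1_singletonE by metis
  have all: "(\<forall>j. P j) \<longleftrightarrow> P i" "(\<exists>j. P j) \<longleftrightarrow> P i" for P :: "'m \<Rightarrow> bool" using i by auto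
  have nrm: "norm x = \<bar>x $ i\<bar>" for x :: "real^'m" by (simp add: norm_vec_def i L2_set_def)
  have sph: "sphere 0 1 = {1, - 1 :: real^'m}"
    by (auto simp: nrm vec_eq_iff all)
  show "sets (sphere_measure :: (real^'m) measure) = Pow {1, - 1}"
  proof -
    have "A \<in> sets borel" if "A \<subseteq> {1, - 1}" for A :: "(real^'m) set"
      using that by (intro borel_closed finite_imp_closed) (auto intro: finite_subset)
    then show ?thesis
      by (auto simp: sets_sphere_measure sets_restrict_space_iff sph)
  qed
  fix a :: "real^'m" assume a: "a \<in> {1, - 1}"
  \<comment> \<open>The cone over \<open>{a}\<close> is the unit segment from the origin to
    \<open>a\<close> without the origin; \<open>l\<close> and \<open>u\<close> are its endpoints in
    increasing order, as \<open>cbox\<close> requires.\<close>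
  define l u where "l = (if a = 1 then 0 else a)" and "u = (if a = 1 then a else 0)"
  have "{r *\<^sub>R \<theta> | r \<theta>. 0 < r \<and> r \<le> 1 \<and> \<theta> \<in> {a}} = cbox l u - {0}" (is "?L = ?R")
  proof (rule set_eqI)
    fix x :: "real^'m"
    have "x \<in> ?L \<longleftrightarrow> (\<exists>r. x $ i = r * a $ i \<and> 0 < r \<and> r \<le> 1)"
      by (auto simp: vec_eq_iff all)
    also have "\<dots> \<longleftrightarrow> 0 < x $ i * a $ i \<and> x $ i * a $ i \<le> 1"
      using a by (auto simp: intro: exI[of _ "x $ i * a $ i"])
    also have "\<dots> \<longleftrightarrow> x \<in> ?R"
      using a by (auto simp: l_def u_def mem_box_cart vec_eq_iff all)
    finally show "x \<in> ?L \<longleftrightarrow> x \<in> ?R" .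
  qed
  then have "emeasure sphere_measure {a} = emeasure lborel (cbox l u - {0})"
    using a assms by (subst emeasure_sphere_measure) (auto simp: sph)
  also have "\<dots> = emeasure lborel (cbox l u)"
    by (rule emeasure_Diff_null_set) auto
  also have "\<dots> = 1"
    using a by (auto simp: emeasure_lborel_cbox_eq l_def u_def Basis_vec_def i inner_axis vec_eq_iff all)
  finally show "emeasure sphere_measure {a} = emeasure (count_space {1, - 1}) {a}"
    using a by simp
qed auto

subsection \<open>Fourier transform of the cone transform\<close>

lemma AE_neq_0: "(\<And>x. x \<noteq> 0 \<Longrightarrow> P x) \<Longrightarrow> AE x in (lborel :: 'a::euclidean_space measure). P x"
  using AE_lborel_singleton[of "0::'a"] by eventually_elim simp

section \<open>Partial Fourier transform of a Schwartz function in the first variable\<close>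

context
  fixes f :: "'a::euclidean_space \<times> 'b::euclidean_space \<Rightarrow> complex"
  assumes f: "f \<in> schwartz"
begin

lemma schwartz_measurable' [measurable]: "f \<in> borel_measurable borel"
  by (rule schwartz_measurable[OF f])

lemma schwartz_slice_decay:
  obtains C where "0 \<le> C" "\<And>x y. cmod (f (x, y)) \<le> C * decay x * decay y"
proof -
  obtain C where C: "0 \<le> C" "\<And>p. cmod (f p) \<le> C * decay p"
    using schwartz_decay[OF f] by blast
  have "cmod (f (x, y)) \<le> C * decay x * decay y" for x y
    using C(2)[of "(x, y)"] mult_left_mono[OF decay_prod_le[of x y] C(1)] by simp
  with C(1) show ?thesis by (rule that)
qed

lemma schwartz_slice_integrable: "integrable lborel (\<lambda>x. f (x, y))"
proof -
  obtain C where "0 \<le> C" "\<And>x y. cmod (f (x, y)) \<le> C * decay x * decay y"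
    using schwartz_slice_decay by blast
  then show ?thesis
    by (intro integrable_decay_bound[where C="C * decay y"]) (simp_all add: mult_ac)
qed

lemma fourier_fst_measurable [measurable]: "fourier_fst f \<in> borel_measurable borel"
proof -
  have "fourier_fst f = (\<lambda>p. LINT x|lborel. exp (- \<i> * of_real (x \<bullet> fst p)) * f (x, snd p))"
    by (simp add: fourier_fst_def fourier_def split_beta')
  also have "\<dots> \<in> borel_measurable (borel \<Otimes>\<^sub>M borel)" by measurable
  finally show ?thesis by (simp only: borel_prod)
qed

lemma fourier_fst_decay:
  obtains C where "\<And>\<xi> y. cmod (fourier_fst f (\<xi>, y)) \<le> C * decay y"
proof -
  obtain C where C: "0 \<le> C" "\<And>x y. cmod (f (x, y)) \<le> C * decay x * decay y"
    using schwartz_slice_decay by blast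
  have "cmod (fourier_fst f (\<xi>, y)) \<le> (C * (LINT x|lborel. decay (x::'a))) * decay y" for \<xi> y
  proof -
    have "cmod (fourier_fst f (\<xi>, y)) \<le> (LINT x|lborel. cmod (f (x, y)))"
      unfolding fourier_fst_def by (simp add: cmod_fourier_le)
    also have "\<dots> \<le> (LINT x|lborel. (C * decay y) * decay (x::'a))"
      by (intro Bochner_Integration.integral_mono integrable_norm schwartz_slice_integrable integrable_mult_right integrable_decay)
        (use C(2) in \<open>simp add: mult_ac\<close>)
    finally show ?thesis by (simp add: mult_ac)
  qed
  then show ?thesis by (rule that)
qed

text \<open>Pointwise inversion in the second variable calls for a continuous function. Dominated
  convergence supplies it, with a majorant that does not depend on \<open>y\<close> because
  \<open>decay\<close> is at most 1.\<close>

lemma continuous_on_fourier_fst: "continuous_on UNIV (\<lambda>y. fourier_fst f (\<xi>, y))"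
proof -
  obtain C where C: "0 \<le> C" "\<And>x y. cmod (f (x, y)) \<le> C * decay x * decay y"
    using schwartz_slice_decay by blast
  show ?thesis
    unfolding continuous_on_sequentially
  proof (intro allI impI ballI, elim conjE)
    fix Y :: "nat \<Rightarrow> 'b" and y assume Y: "Y \<longlonglongrightarrow> y"
    have "(\<lambda>n. LINT x|lborel. exp (- \<i> * of_real (x \<bullet> \<xi>)) * f (x, Y n))
        \<longlonglongrightarrow> (LINT x|lborel. exp (- \<i> * of_real (x \<bullet> \<xi>)) * f (x, y))"
    proof (rule integral_dominated_convergence[where w = "\<lambda>x. C * decay x"])
      show "AE x in lborel. (\<lambda>n. exp (- \<i> * of_real (x \<bullet> \<xi>)) * f (x, Y n)) \<longlonglongrightarrow> exp (- \<i> * of_real (x \<bullet> \<xi>)) * f (x, y)"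
      proof (intro AE_I2 tendsto_mult tendsto_const)
        fix x :: 'a
        have "(\<lambda>n. (x, Y n)) \<longlonglongrightarrow> (x, y)" by (intro tendsto_intros Y)
        then show "(\<lambda>n. f (x, Y n)) \<longlonglongrightarrow> f (x, y)"
          using continuous_on_tendsto_compose[OF schwartz_continuous_on[OF f, of UNIV]] by simp
      qed
      show "AE x in lborel. norm (exp (- \<i> * of_real (x \<bullet> \<xi>)) * f (x, Y n)) \<le> C * decay x" for n
      proof (rule AE_I2)
        fix x :: 'a
        have "C * decay x * decay (Y n) \<le> C * decay x"
          using C(1) decay_pos[of x] by (intro mult_left_le decay_le_1) auto
        then show "norm (exp (- \<i> * of_real (x \<bullet> \<xi>)) * f (x, Y n)) \<le> C * decay x"
          using C(2)[of x "Y n"] by (simp add: norm_mult)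
      qed
    qed (use integrable_decay in auto)
    then show "((\<lambda>y. fourier_fst f (\<xi>, y)) \<circ> Y) \<longlonglongrightarrow> fourier_fst f (\<xi>, y)"
      by (simp add: fourier_fst_def fourier_def o_def)
  qed
qed

lemma fourier_fourier_fst: "fourier (\<lambda>y. fourier_fst f (\<xi>, y)) \<eta> = fourier f (\<xi>, \<eta>)"
  using fun_cong[OF fourier_iter_eq_fourier[OF schwartz_integrable[OF f]], of "(\<xi>, \<eta>)"]
  by (simp add: fourier_iter_def)

lemma integrable_fourier_fst: "integrable lborel (\<lambda>y. fourier_fst f (\<xi>, y))"
  using fourier_fst_decay by (metis integrable_decay_bound continuous_on_fourier_fst borel_measurable_continuous_onI)

text \<open>Decay in \<open>\<eta>\<close> is inherited from the joint transform on the product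
  space; this spares a proof that the partially transformed slices are again Schwartz
  functions.\<close>

lemma integrable_fourier_slice: "integrable lborel (\<lambda>\<eta>. fourier f (\<xi>, \<eta>))"
proof -
  obtain C where C: "0 \<le> C" "\<And>p. cmod (fourier f p) \<le> C * decay p"
    using fourier_decay[OF f] by blast
  have "cmod (fourier f (\<xi>, \<eta>)) \<le> C * decay \<eta>" for \<eta>
    using C(2)[of "(\<xi>, \<eta>)"] mult_left_mono[OF decay_Pair_le(2)[of \<xi> \<eta>] C(1)] by simp
  then show ?thesis
    by (intro integrable_decay_bound[where C=C]) simp_all
qed

lemma plancherel_slice:
  "(\<integral>\<^sup>+\<eta>. ennreal ((cmod (fourier f (\<xi>, \<eta>)))\<^sup>2) \<partial>lborel)
    = ennreal ((2 * pi) ^ DIM('b)) * (\<integral>\<^sup>+y. ennreal ((cmod (fourier_fst f (\<xi>, y)))\<^sup>2) \<partial>lborel)"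
  and fourier_inversion_slice:
  "fourier (\<lambda>\<eta>. fourier f (\<xi>, \<eta>)) y = of_real ((2 * pi) ^ DIM('b)) * fourier_fst f (\<xi>, - y)"
proof -
  obtain C where C: "\<And>\<xi> y. cmod (fourier_fst f (\<xi>, y)) \<le> C * decay y"
    using fourier_fst_decay by blast
  have "0 \<le> C * decay (0::'b)" by (rule order.trans[OF norm_ge_zero C])
  then have "0 \<le> C" by (simp add: zero_le_mult_iff decay_def)
  then have bd: "cmod (fourier_fst f (\<xi>, y)) \<le> C" for y
    using C[of \<xi> y] mult_left_le[OF decay_le_1, of C y] by simp
  have eq: "fourier (\<lambda>y. fourier_fst f (\<xi>, y)) = (\<lambda>\<eta>. fourier f (\<xi>, \<eta>))"
    by (simp add: fun_eq_iff fourier_fourier_fst)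
  note * = continuous_on_fourier_fst[of \<xi>] bd integrable_fourier_fst
  show "(\<integral>\<^sup>+\<eta>. ennreal ((cmod (fourier f (\<xi>, \<eta>)))\<^sup>2) \<partial>lborel)
    = ennreal ((2 * pi) ^ DIM('b)) * (\<integral>\<^sup>+y. ennreal ((cmod (fourier_fst f (\<xi>, y)))\<^sup>2) \<partial>lborel)"
    using plancherel[OF *] integrable_fourier_slice[of \<xi>] by (simp add: eq)
  show "fourier (\<lambda>\<eta>. fourier f (\<xi>, \<eta>)) y = of_real ((2 * pi) ^ DIM('b)) * fourier_fst f (\<xi>, - y)"
    using fourier_inversion[OF *] integrable_fourier_slice[of \<xi>] by (simp add: eq)
qed

end

lemma fourier_scale:
  fixes h :: "'a::euclidean_space \<Rightarrow> complex"
  assumes [measurable]: "h \<in> borel_measurable borel" and "0 < c"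
  shows "fourier (\<lambda>v. h (c *\<^sub>R v)) \<eta> = fourier h (\<eta> /\<^sub>R c) / of_real (c ^ DIM('a))"
proof -
  have "fourier h (\<eta> /\<^sub>R c) = c ^ DIM('a) *\<^sub>R (LINT v|lborel. exp (- \<i> * of_real ((0 + c *\<^sub>R v) \<bullet> (\<eta> /\<^sub>R c))) * h (0 + c *\<^sub>R v))"
    unfolding fourier_def using \<open>0 < c\<close> by (subst integral_lborel_affine[where c=c and t=0]) simp_all
  also have "\<dots> = c ^ DIM('a) *\<^sub>R fourier (\<lambda>v. h (c *\<^sub>R v)) \<eta>"
  proof -
    have "(0 + c *\<^sub>R v) \<bullet> (\<eta> /\<^sub>R c) = v \<bullet> \<eta>" for v using \<open>0 < c\<close> by simp
    then show ?thesis by (simp only: fourier_def add_0)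
  qed
  finally show ?thesis using \<open>0 < c\<close> by (simp add: scaleR_conv_of_real)
qed

lemma cone_integrand_integrable:
  fixes f :: "'a::euclidean_space \<times> 'a \<Rightarrow> complex"
  assumes f: "f \<in> schwartz"
  shows "integrable lborel (\<lambda>y. f (u + s *\<^sub>R y, y))"
proof -
  have [measurable]: "f \<in> borel_measurable borel" by (rule schwartz_measurable[OF f])
  obtain C where C: "0 \<le> C" "\<And>p. cmod (f p) \<le> C * decay p"
    using schwartz_decay[OF f] by blast
  have "cmod (f (x, y)) \<le> C * decay y" for x y
    using C(2)[of "(x, y)"] mult_left_mono[OF decay_Pair_le(2)[of x y] C(1)] by simp
  then show ?thesis
    by (intro integrable_decay_bound[where C=C]) simp_all
qed

lemma fourier_fst_cone_transform:
  fixes f :: "(real^'m::finite) \<times> (real^'m) \<Rightarrow> complex"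
  assumes f: "f \<in> schwartz"
  shows "fourier_fst (cone_transform f) (\<xi>, v) = fourier f (\<xi>, - (norm v *\<^sub>R \<xi>))"
proof -
  have [measurable]: "f \<in> borel_measurable borel" by (rule schwartz_measurable[OF f])
  let ?s = "norm v"
  let ?k = "\<lambda>y u. exp (- \<i> * of_real (u \<bullet> \<xi>)) * f (u + ?s *\<^sub>R y, y)"
  have shift: "(LINT u|lborel. h (u + ?s *\<^sub>R y)) = (LINT u|lborel. h u)"
    if "h \<in> borel_measurable borel" for h :: "real^'m \<Rightarrow> 'c::{banach, second_countable_topology}" and y
    using integral_lborel_affine[OF that, of 1 "?s *\<^sub>R y"] by (simp add: add.commute)
  have int: "integrable (lborel \<Otimes>\<^sub>M lborel) (\<lambda>(y, u). ?k y u)"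
  proof (rule lborel_pair.Fubini_integrable)
    \<comment> \<open>Under absolute values the exponential disappears and translation invariance
      removes the shift in \<open>u\<close>, so joint integrability reduces to that of
      \<open>f\<close>.\<close>
    have "integrable (lborel \<Otimes>\<^sub>M lborel) (\<lambda>(x, y). cmod (f (x, y)))"
      using integrable_norm[OF schwartz_integrable[OF f]] by (simp add: lborel_prod split_beta')
    from lborel_pair.integrable_snd[OF this]
    show "integrable lborel (\<lambda>y. LINT u|lborel. norm (case (y, u) of (y, u) \<Rightarrow> ?k y u))"
      using shift[of "\<lambda>x. cmod (f (x, y))" y for y] by (simp add: norm_mult)
    show "AE y in lborel. integrable lborel (\<lambda>u. case (y, u) of (y, u) \<Rightarrow> ?k y u)"
    proof (rule AE_I2)
      fix y
      have "integrable lborel (\<lambda>u. f (u + ?s *\<^sub>R y, y))"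
        using integrable_lborel_affine[OF schwartz_slice_integrable[OF f], of 1 "?s *\<^sub>R y" y]
        by (simp add: add.commute)
      from integrable_exp_mult[OF this, of \<xi>]
      show "integrable lborel (\<lambda>u. case (y, u) of (y, u) \<Rightarrow> ?k y u)" by simp
    qed
  qed measurable
  have inner: "(LINT u|lborel. ?k y u) = exp (- \<i> * of_real (y \<bullet> - (?s *\<^sub>R \<xi>))) * fourier_fst f (\<xi>, y)" for y
  proof -
    have "(LINT u|lborel. ?k y u) = (LINT u|lborel. exp (- \<i> * of_real (y \<bullet> - (?s *\<^sub>R \<xi>)))
        * (exp (- \<i> * of_real ((u + ?s *\<^sub>R y) \<bullet> \<xi>)) * f (u + ?s *\<^sub>R y, y)))"
    proof (intro Bochner_Integration.integral_cong refl)
      fix u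
      \<comment> \<open>Centring the exponential at the shifted point leaves a phase in
        \<open>y\<close> alone, which is the Fourier kernel at the frequency
        \<open>- (?s *\<^sub>R \<xi>)\<close>.\<close>
      have "exp (- \<i> * of_real (u \<bullet> \<xi>))
          = exp (- \<i> * of_real (y \<bullet> - (?s *\<^sub>R \<xi>))) * exp (- \<i> * of_real ((u + ?s *\<^sub>R y) \<bullet> \<xi>))"
        by (simp add: inner_add_left algebra_simps flip: exp_add)
      then show "?k y u = exp (- \<i> * of_real (y \<bullet> - (?s *\<^sub>R \<xi>)))
        * (exp (- \<i> * of_real ((u + ?s *\<^sub>R y) \<bullet> \<xi>)) * f (u + ?s *\<^sub>R y, y))"
        by (simp only: mult.assoc)
    qed
    also have "\<dots> = exp (- \<i> * of_real (y \<bullet> - (?s *\<^sub>R \<xi>)))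
        * (LINT u|lborel. exp (- \<i> * of_real ((u + ?s *\<^sub>R y) \<bullet> \<xi>)) * f (u + ?s *\<^sub>R y, y))"
      by (rule integral_mult_right_zero)
    also have "(LINT u|lborel. exp (- \<i> * of_real ((u + ?s *\<^sub>R y) \<bullet> \<xi>)) * f (u + ?s *\<^sub>R y, y)) = fourier_fst f (\<xi>, y)"
      by (subst shift) (simp_all add: fourier_fst_def fourier_def)
    finally show ?thesis .
  qed
  have "fourier_fst (cone_transform f) (\<xi>, v) = (LINT u|lborel. LINT y|lborel. ?k y u)"
    by (simp add: fourier_fst_def fourier_def cone_transform_def)
  also have "\<dots> = (LINT y|lborel. LINT u|lborel. ?k y u)"
    by (rule lborel_pair.Fubini_integral[OF int])
  also have "\<dots> = fourier (\<lambda>y. fourier_fst f (\<xi>, y)) (- (?s *\<^sub>R \<xi>))"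
    by (simp only: inner fourier_def)
  finally show ?thesis by (simp only: fourier_fourier_fst[OF f])
qed

text \<open>Vectors of equal norm are related by an orthogonal map. For the partial transform
  \<open>y\<close> is only a parameter, so invariance is immediate; for the joint one it also uses
  invariance of Lebesgue measure and of the inner product.\<close>

lemma
  fixes f :: "(real^'m::finite) \<times> (real^'m) \<Rightarrow> complex"
  assumes f: "f \<in> schwartz_r" and eq: "norm \<eta> = norm \<eta>'"
  shows fourier_fst_radial: "fourier_fst f (\<xi>, \<eta>) = fourier_fst f (\<xi>, \<eta>')"
    and fourier_radial: "fourier f (\<xi>, \<eta>) = fourier f (\<xi>, \<eta>')"
proof -
  have fs: "f \<in> schwartz" using f unfolding schwartz_r_def by blast
  note [measurable] = fourier_fst_measurable[OF fs]
  obtain U where U: "orthogonal_transformation U" "U \<eta> = \<eta>'"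
    using orthogonal_transformation_exists[OF eq] .
  have [measurable]: "U \<in> borel \<rightarrow>\<^sub>M borel"
    using U(1) by (intro borel_measurable_continuous_onI linear_continuous_on)
      (simp add: orthogonal_transformation_def linear_conv_bounded_linear)
  have inv: "f (x, y) = f (x, U y)" for x y
    using f U(1) unfolding schwartz_r_def by blast
  have fU: "fourier_fst f (\<xi>, U y) = fourier_fst f (\<xi>, y)" for y
    by (simp add: fourier_fst_def inv[symmetric])
  show "fourier_fst f (\<xi>, \<eta>) = fourier_fst f (\<xi>, \<eta>')"
    using fU[of \<eta>] U(2) by simp
  have iter: "fourier f (\<xi>, \<eta>) = (LINT y|lborel. exp (- \<i> * of_real (y \<bullet> \<eta>)) * fourier_fst f (\<xi>, y))" for \<eta>
    by (subst fourier_fourier_fst[OF fs, symmetric]) (rule fourier_def)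
  have "fourier f (\<xi>, \<eta>') = (LINT y|distr lborel borel U. exp (- \<i> * of_real (y \<bullet> \<eta>')) * fourier_fst f (\<xi>, y))"
    unfolding lborel_distr_orthogonal[OF U(1)] by (rule iter)
  also have "\<dots> = (LINT y|lborel. exp (- \<i> * of_real (U y \<bullet> U \<eta>)) * fourier_fst f (\<xi>, U y))"
    by (subst integral_distr) (simp_all add: U(2))
  also have "\<dots> = fourier f (\<xi>, \<eta>)"
    using U(1) by (simp add: fU iter orthogonal_transformation_def)
  finally show "fourier f (\<xi>, \<eta>) = fourier f (\<xi>, \<eta>')" ..
qed

lemma fourier_fst_cone_transform_radial:
  fixes f :: "(real^'m::finite) \<times> (real^'m) \<Rightarrow> complex"
  assumes f: "f \<in> schwartz_r"
  shows "fourier_fst (cone_transform f) (\<xi>, v) = fourier f (\<xi>, norm \<xi> *\<^sub>R v)"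
proof -
  have fs: "f \<in> schwartz" using f unfolding schwartz_r_def by blast
  show ?thesis
    unfolding fourier_fst_cone_transform[OF fs] by (intro fourier_radial[OF f]) simp
qed

text \<open>Undoing the dilation by \<open>norm \<xi>\<close> costs its \<open>CARD('m)\<close>-th
  power, and transforming a second time contributes \<open>(2 * pi) ^ CARD('m)\<close> and a
  reflection.\<close>

lemma fourier_iter_cone_transform:
  fixes f :: "(real^'m::finite) \<times> (real^'m) \<Rightarrow> complex"
  assumes f: "f \<in> schwartz_r" and "\<xi> \<noteq> 0"
  shows "fourier_iter (cone_transform f) (\<xi>, \<eta>)
    = of_real ((2 * pi / norm \<xi>) ^ CARD('m)) * fourier_fst f (\<xi>, - (\<eta> /\<^sub>R norm \<xi>))"
proof -
  have fs: "f \<in> schwartz" using f unfolding schwartz_r_def by blast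
  note [measurable] = schwartz_measurable[OF fs]
  have "fourier_iter (cone_transform f) (\<xi>, \<eta>) = fourier (\<lambda>v. fourier f (\<xi>, norm \<xi> *\<^sub>R v)) \<eta>"
    by (simp add: fourier_iter_def fourier_fst_cone_transform_radial[OF f])
  also have "\<dots> = fourier (\<lambda>v. fourier f (\<xi>, v)) (\<eta> /\<^sub>R norm \<xi>) / of_real (norm \<xi> ^ CARD('m))"
    using \<open>\<xi> \<noteq> 0\<close> by (subst fourier_scale[of "\<lambda>v. fourier f (\<xi>, v)"]) simp_all
  finally show ?thesis
    by (simp add: fourier_inversion_slice[OF fs] power_divide)
qed

text \<open>Squaring doubles both exponents of \<open>2 * pi / norm \<xi>\<close>; the Jacobian of
  rescaling \<open>\<eta>\<close> gives back half of the powers of \<open>norm \<xi>\<close>. The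
  reflection is absorbed by a negative scaling factor.\<close>

lemma nn_integral_fourier_iter_cone_transform:
  fixes f :: "(real^'m::finite) \<times> (real^'m) \<Rightarrow> complex"
  assumes f: "f \<in> schwartz_r" and "\<xi> \<noteq> 0" and "0 \<le> w"
  shows "(\<integral>\<^sup>+\<eta>. ennreal ((cmod (fourier_iter (cone_transform f) (\<xi>, \<eta>)))\<^sup>2 * w) \<partial>lborel)
    = ennreal (w * (2 * pi) ^ (2 * CARD('m)) / norm \<xi> ^ CARD('m))
      * (\<integral>\<^sup>+y. ennreal ((cmod (fourier_fst f (\<xi>, y)))\<^sup>2) \<partial>lborel)" (is "?L = _ * ?A")
proof -
  have fs: "f \<in> schwartz" using f unfolding schwartz_r_def by blast
  note [measurable] = fourier_fst_measurable[OF fs]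
  let ?c = "2 * pi / norm \<xi>" and ?d = "CARD('m)"
  have "?L = (\<integral>\<^sup>+\<eta>. ennreal (w * ?c ^ (2 * ?d)) * ennreal ((cmod (fourier_fst f (\<xi>, 0 + (- inverse (norm \<xi>)) *\<^sub>R \<eta>)))\<^sup>2) \<partial>lborel)"
  proof (rule nn_integral_cong)
    fix \<eta>
    have eq: "(cmod (fourier_iter (cone_transform f) (\<xi>, \<eta>)))\<^sup>2 * w
        = (w * ?c ^ (2 * ?d)) * (cmod (fourier_fst f (\<xi>, 0 + (- inverse (norm \<xi>)) *\<^sub>R \<eta>)))\<^sup>2"
      unfolding fourier_iter_cone_transform[OF f \<open>\<xi> \<noteq> 0\<close>] norm_mult norm_of_real power_mult_distrib
      by (simp add: power_even_abs power_mult[symmetric] mult_ac)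
    show "ennreal ((cmod (fourier_iter (cone_transform f) (\<xi>, \<eta>)))\<^sup>2 * w)
        = ennreal (w * ?c ^ (2 * ?d)) * ennreal ((cmod (fourier_fst f (\<xi>, 0 + (- inverse (norm \<xi>)) *\<^sub>R \<eta>)))\<^sup>2)"
      unfolding eq using \<open>0 \<le> w\<close> by (intro ennreal_mult) simp_all
  qed
  also have "\<dots> = ennreal (w * ?c ^ (2 * ?d)) * (\<integral>\<^sup>+\<eta>. ennreal ((cmod (fourier_fst f (\<xi>, 0 + (- inverse (norm \<xi>)) *\<^sub>R \<eta>)))\<^sup>2) \<partial>lborel)"
    by (rule nn_integral_cmult) measurable
  also have "\<dots> = ennreal (w * (2 * pi) ^ (2 * ?d) / norm \<xi> ^ ?d) * (ennreal (\<bar>- inverse (norm \<xi>)\<bar> ^ ?d) *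
      (\<integral>\<^sup>+\<eta>. ennreal ((cmod (fourier_fst f (\<xi>, 0 + (- inverse (norm \<xi>)) *\<^sub>R \<eta>)))\<^sup>2) \<partial>lborel))"
  proof -
    have "w * ?c ^ (2 * ?d) = w * (2 * pi) ^ (2 * ?d) / norm \<xi> ^ ?d * \<bar>- inverse (norm \<xi>)\<bar> ^ ?d"
    proof -
      define N where "N = norm \<xi> ^ ?d"
      have "?c ^ (2 * ?d) = (2 * pi) ^ (2 * ?d) / (N * N)"
        by (simp only: power_even_eq power2_eq_square power_divide times_divide_times_eq N_def)
      moreover have "\<bar>- inverse (norm \<xi>)\<bar> ^ ?d = inverse N"
        by (simp add: N_def power_inverse)
      ultimately show ?thesis by (simp add: N_def[symmetric] divide_inverse)
    qed
    then show ?thesis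
      using \<open>0 \<le> w\<close> by (simp only: mult.assoc[symmetric]) (simp flip: ennreal_mult)
  qed
  also have "ennreal (\<bar>- inverse (norm \<xi>)\<bar> ^ ?d) *
      (\<integral>\<^sup>+\<eta>. ennreal ((cmod (fourier_fst f (\<xi>, 0 + (- inverse (norm \<xi>)) *\<^sub>R \<eta>)))\<^sup>2) \<partial>lborel) = ?A"
    using nn_integral_lborel_affine[of "\<lambda>y. ennreal ((cmod (fourier_fst f (\<xi>, y)))\<^sup>2)" "- inverse (norm \<xi>)" 0]
      \<open>\<xi> \<noteq> 0\<close> by simp
  finally show ?thesis .
qed

text \<open>Polar coordinates \<open>y = z \<theta>\<close> in the cone integral. Any unit vector
  \<open>e\<close> will do, since the cone transform sees its second argument only through the
  norm.\<close>

lemma radial_cone_transform_eq: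
  fixes f :: "(real^'m::finite) \<times> (real^'m) \<Rightarrow> complex"
  assumes f: "f \<in> schwartz" and F: "\<And>x y. f (x, y) = F (x, norm y)" and s: "0 \<le> s" and e: "norm e = 1"
  shows "radial_cone_transform F (u, s) = cone_transform f (u, s *\<^sub>R e)"
proof -
  let ?d = "CARD('m)" and ?k = "\<lambda>y. f (u + s *\<^sub>R y, y)"
  have k: "integrable lborel ?k" by (rule cone_integrand_integrable[OF f])
  have set_eq: "(LINT z:{0..}|lborel. z ^ (?d - 1) *\<^sub>R ?k (z *\<^sub>R \<theta>))
      = (LINT z:{0..}|lborel. F (u + (z * s) *\<^sub>R \<theta>, z) * of_real (z ^ (?d - 1)))" if "norm \<theta> = 1" for \<theta>
    by (rule set_lebesgue_integral_cong) (auto simp: F that scaleR_conv_of_real[where 'a=complex] mult_ac)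
  have "cone_transform f (u, s *\<^sub>R e) = (LINT y|lborel. ?k y)"
    using s e by (simp add: cone_transform_def)
  also have "\<dots> = (LINT \<theta>|sphere_measure. (LINT z:{0..}|lborel. z ^ (?d - 1) *\<^sub>R ?k (z *\<^sub>R \<theta>)))"
    using integral_polar[OF k] by simp
  also have "\<dots> = radial_cone_transform F (u, s)"
  proof (cases "?d = 1")
    case False
    have "(LINT \<theta>|sphere_measure. (LINT z:{0..}|lborel. z ^ (?d - 1) *\<^sub>R ?k (z *\<^sub>R \<theta>)))
        = (LINT \<theta>|sphere_measure. (LINT z:{0..}|lborel. F (u + (z * s) *\<^sub>R \<theta>, z) * of_real (z ^ (?d - 1))))"
      by (intro Bochner_Integration.integral_cong refl set_eq) (simp add: space_sphere_measure)
    with False show ?thesis by (simp add: radial_cone_transform_def)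
  next
    case True
    have sph: "(sphere_measure :: (real^'m) measure) = count_space {1, - 1}"
      by (rule sphere_measure_dim_1[OF True])
    have nrm: "norm (1 :: real^'m) = 1"
      using space_sphere_measure[where 'a="real^'m"] by (simp add: sph set_eq_iff) metis
    have vec: "vec (z * s) = (z * s) *\<^sub>R (1 :: real^'m)" for z by (simp add: vec_eq_iff)
    \<comment> \<open>With respect to a counting measure, almost everywhere means at every point, so
      both rays are covered.\<close>
    have int: "set_integrable lborel {0..} (\<lambda>z. F (u + (z * s) *\<^sub>R \<theta>, z))" if "\<theta> \<in> {1, - 1 :: real^'m}" for \<theta>
    proof -
      have "set_integrable lborel {0..} (\<lambda>z. z ^ (?d - 1) *\<^sub>R ?k (z *\<^sub>R \<theta>))"
        using AE_set_integrable_polar[OF k] that unfolding sph AE_count_space by auto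
      moreover have "norm \<theta> = 1" using that nrm by auto
      ultimately show ?thesis
        using True by (subst set_integrable_cong[OF refl refl, where f'="\<lambda>z. z ^ (?d - 1) *\<^sub>R ?k (z *\<^sub>R \<theta>)"])
          (auto simp: F mult.commute)
    qed
    have ne: "(1 :: real^'m) \<noteq> - 1" by (simp add: vec_eq_iff)
    have "(LINT \<theta>|sphere_measure. (LINT z:{0..}|lborel. z ^ (?d - 1) *\<^sub>R ?k (z *\<^sub>R \<theta>)))
        = (LINT z:{0..}|lborel. F (u + (z * s) *\<^sub>R 1, z)) + (LINT z:{0..}|lborel. F (u + (z * s) *\<^sub>R - 1, z))"
      using set_eq[of 1] set_eq[of "- 1"] nrm ne True
      by (simp add: sph lebesgue_integral_count_space_finite)
    also have "\<dots> = (LINT z:{0..}|lborel. F (u + vec (z * s), z) + F (u - vec (z * s), z))"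
      using set_integral_add(2)[OF int[of 1] int[of "- 1"]] by (simp add: vec)
    finally show ?thesis using True by (simp add: radial_cone_transform_def)
  qed
  finally show ?thesis ..
qed

text \<open>The profile \<open>H\<close> is tied to \<open>G\<close> only on the nonnegative
  half-line. There it is replaced by \<open>G\<close> along a fixed ray, which is where
  measurability comes from.\<close>

lemma nn_integral_radial_slice:
  fixes G :: "'a::euclidean_space \<Rightarrow> complex" and H :: "real \<Rightarrow> complex"
  assumes [measurable]: "G \<in> borel_measurable borel" and rad: "\<And>x y. norm x = norm y \<Longrightarrow> G x = G y"
    and H: "\<And>y. H (norm y) = G y" and w: "0 \<le> w"
  shows "emeasure (sphere_measure :: 'a measure) (sphere 0 1)
      * (\<integral>\<^sup>+z\<in>{0..}. ennreal ((cmod (H z))\<^sup>2 * w * z ^ (DIM('a) - 1)) \<partial>lborel)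
    = ennreal w * (\<integral>\<^sup>+y. ennreal ((cmod (G y))\<^sup>2) \<partial>lborel)"
proof -
  obtain e :: 'a where "e \<in> Basis" using nonempty_Basis by blast
  then have e: "norm e = 1" by simp
  let ?h = "\<lambda>z. ennreal w * ennreal ((cmod (G (z *\<^sub>R e)))\<^sup>2)"
  have "(\<integral>\<^sup>+z\<in>{0..}. ennreal ((cmod (H z))\<^sup>2 * w * z ^ (DIM('a) - 1)) \<partial>lborel)
      = (\<integral>\<^sup>+z. ennreal (indicator {0..} z * z ^ (DIM('a) - 1)) * ?h z \<partial>lborel)"
  proof (rule nn_integral_cong)
    fix z :: real
    have "H z = G (z *\<^sub>R e)" if "0 \<le> z" using H[of "z *\<^sub>R e"] that e by simp
    then show "ennreal ((cmod (H z))\<^sup>2 * w * z ^ (DIM('a) - 1)) * indicator {0..} z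
        = ennreal (indicator {0..} z * z ^ (DIM('a) - 1)) * ?h z"
      using w by (auto simp: indicator_def mult_ac simp flip: ennreal_mult)
  qed
  also have "\<dots> = (\<integral>\<^sup>+z. ?h z \<partial>radial_measure (DIM('a) - 1))"
    by (simp add: nn_integral_radial_measure)
  finally have "emeasure (sphere_measure :: 'a measure) (sphere 0 1)
      * (\<integral>\<^sup>+z\<in>{0..}. ennreal ((cmod (H z))\<^sup>2 * w * z ^ (DIM('a) - 1)) \<partial>lborel)
    = (\<integral>\<^sup>+y. ?h (norm y) \<partial>(lborel :: 'a measure))"
    by (subst nn_integral_radial) simp_all
  also have "\<dots> = (\<integral>\<^sup>+y. ennreal w * ennreal ((cmod (G y))\<^sup>2) \<partial>lborel)"
    by (intro nn_integral_cong arg_cong2[where f="(*)"] refl) (simp add: rad[of "norm y *\<^sub>R e" y for y] e)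
  also have "\<dots> = ennreal w * (\<integral>\<^sup>+y. ennreal ((cmod (G y))\<^sup>2) \<partial>lborel)"
    by (rule nn_integral_cmult) simp
  finally show ?thesis .
qed

section \<open>Comparing norms slice by slice, and the weights\<close>

lemma ennreal_sqrt_mono: "x \<le> y \<Longrightarrow> ennreal_sqrt x \<le> ennreal_sqrt y"
  by (auto simp: ennreal_sqrt_def top.extremum_unique intro!: ennreal_leI enn2real_mono simp: less_top)

lemma ennreal_sqrt_cmult:
  assumes "0 < c"
  shows "ennreal_sqrt (ennreal (c\<^sup>2) * x) = ennreal c * ennreal_sqrt x"
  using assms
  by (cases x) (auto simp: ennreal_sqrt_def ennreal_mult_top real_sqrt_mult ennreal_mult_eq_top_iff
      simp flip: ennreal_mult)

text \<open>The constant is first moved to the side of \<open>P\<close> by its inverse. Pulling it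
  out of the integral then asks for measurability of \<open>P\<close> alone, and not of the
  integrand built from the cone transform.\<close>

lemma ennreal_sqrt_nn_integral_le:
  assumes [measurable]: "P \<in> borel_measurable M" and "0 < c"
    and le: "AE x in M. P x \<le> ennreal (c\<^sup>2) * Q x"
  shows "ennreal_sqrt (\<integral>\<^sup>+x. P x \<partial>M) \<le> ennreal c * ennreal_sqrt (\<integral>\<^sup>+x. Q x \<partial>M)"
proof -
  have inv: "ennreal (c\<^sup>2) * (ennreal (inverse (c\<^sup>2)) * x) = x"
    "ennreal (inverse (c\<^sup>2)) * (ennreal (c\<^sup>2) * x) = x" for x
    using \<open>0 < c\<close> by (simp_all add: mult.assoc[symmetric] flip: ennreal_mult)
  have "(\<integral>\<^sup>+x. P x \<partial>M) = ennreal (c\<^sup>2) * (\<integral>\<^sup>+x. ennreal (inverse (c\<^sup>2)) * P x \<partial>M)"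
    by (simp add: nn_integral_cmult inv)
  also have "\<dots> \<le> ennreal (c\<^sup>2) * (\<integral>\<^sup>+x. Q x \<partial>M)"
  proof (intro mult_left_mono nn_integral_mono_AE)
    show "AE x in M. ennreal (inverse (c\<^sup>2)) * P x \<le> Q x"
      using le
    proof eventually_elim
      case (elim x)
      then have "ennreal (inverse (c\<^sup>2)) * P x \<le> ennreal (inverse (c\<^sup>2)) * (ennreal (c\<^sup>2) * Q x)"
        by (intro mult_left_mono) auto
      then show ?case by (simp only: inv)
    qed
  qed simp
  finally show ?thesis
    using ennreal_sqrt_mono ennreal_sqrt_cmult[OF \<open>0 < c\<close>] by metis
qed

text \<open>The two sides are asymptotically equal as \<open>r\<close> grows, so the shift of the
  exponent by \<open>d / 2\<close> measures exactly the smoothing of order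
  \<open>(n - 1) / 2\<close>.\<close>

lemma weight_le:
  fixes r \<gamma> :: real
  assumes "0 < r"
  shows "(1 + r\<^sup>2) powr \<gamma> \<le> (1 + r\<^sup>2) powr (\<gamma> + real d / 2) / r ^ d"
proof -
  have "r ^ d = (r\<^sup>2) powr (real d / 2)"
  proof -
    have "r ^ d = (r powr 2) powr (real d / 2)"
      unfolding powr_powr using assms by (simp add: powr_realpow)
    then show ?thesis using assms by simp
  qed
  also have "\<dots> \<le> (1 + r\<^sup>2) powr (real d / 2)"
    by (intro powr_mono2) auto
  finally have "(1 + r\<^sup>2) powr \<gamma> * r ^ d \<le> (1 + r\<^sup>2) powr \<gamma> * (1 + r\<^sup>2) powr (real d / 2)"
    by (intro mult_left_mono) auto
  then show ?thesis
    using assms by (simp add: powr_add pos_le_divide_eq)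
qed

theorem corollary3:
  fixes n :: nat and \<gamma> :: real
    and f :: "(real^'m::finite) \<times> (real^'m) \<Rightarrow> complex"
    and F :: "(real^'m) \<times> real \<Rightarrow> complex"
  assumes "n \<ge> 2" and "CARD('m) = n - 1"
    and "f \<in> schwartz_r"
    and "\<And>x y. f (x, y) = F (x, norm y)"
  shows "aniso_norm \<gamma> (fourier f) \<le>
           ennreal ((2 * pi) powr ((1 - real n) / 2)) *
           aniso_norm (\<gamma> + (real n - 1) / 2) (fourier_iter (cone_transform f)) \<and>
         radial_norm \<gamma> (n - 2) F \<le>
           ennreal ((2 * pi) powr ((1 - real n) / 2)) *
           radial_norm (\<gamma> + (real n - 1) / 2) (n - 2) (radial_cone_transform F)"
proof -
  let ?d = "CARD('m)" and ?w = "\<lambda>\<gamma> \<xi> :: real^'m. (1 + (norm \<xi>)\<^sup>2) powr \<gamma>"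
  have d: "real n - 1 = real ?d" "n - 2 = ?d - 1" using assms(1,2) by auto
  have f: "f \<in> schwartz" using assms(3) unfolding schwartz_r_def by blast
  note [measurable] = schwartz_measurable[OF f] fourier_fst_measurable[OF f]
  define c where "c = (2 * pi) powr ((1 - real n) / 2)"
  have c: "0 < c" by (simp add: c_def)
  have "c\<^sup>2 = (2 * pi) powr ((1 - real n) / 2 + (1 - real n) / 2)"
    unfolding c_def power2_eq_square powr_add ..
  also have "(1 - real n) / 2 + (1 - real n) / 2 = - real ?d"
    using d by (simp add: field_simps)
  finally have "c\<^sup>2 = (2 * pi) powr (- real ?d)" .
  then have c2: "c\<^sup>2 = inverse ((2 * pi) ^ ?d)"
    by (simp add: powr_minus powr_realpow)
  define A where "A \<xi> = (\<integral>\<^sup>+y. ennreal ((cmod (fourier_fst f (\<xi>, y)))\<^sup>2) \<partial>lborel)" for \<xi>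
  have A [measurable]: "A \<in> borel_measurable borel"
    unfolding A_def by measurable
  have w: "?w \<gamma> \<xi> \<le> ?w (\<gamma> + (real n - 1) / 2) \<xi> / norm \<xi> ^ ?d" if "\<xi> \<noteq> 0" for \<xi>
    unfolding d using that by (intro weight_le) simp

  have P: "(\<integral>\<^sup>+\<eta>. ennreal ((cmod (fourier f (\<xi>, \<eta>)))\<^sup>2 * ?w \<gamma> \<xi>) \<partial>lborel)
      = ennreal (?w \<gamma> \<xi> * (2 * pi) ^ ?d) * A \<xi>" for \<xi>
    using plancherel_slice[OF f, of \<xi>]
    by (simp add: ennreal_mult nn_integral_multc A_def mult_ac)
  have 1: "aniso_norm \<gamma> (fourier f) \<le> ennreal c * aniso_norm (\<gamma> + (real n - 1) / 2) (fourier_iter (cone_transform f))"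
    unfolding aniso_norm_def
  proof (rule ennreal_sqrt_nn_integral_le[OF _ c], goal_cases)
    case 1
    show ?case unfolding P by measurable
  next
    case 2
    show ?case
    proof (rule AE_neq_0)
      fix \<xi> :: "real^'m" assume \<xi>: "\<xi> \<noteq> 0"
      have "?w \<gamma> \<xi> * (2 * pi) ^ ?d \<le> c\<^sup>2 * (?w (\<gamma> + (real n - 1) / 2) \<xi> * (2 * pi) ^ (2 * ?d) / norm \<xi> ^ ?d)"
      proof -
        \<comment> \<open>\<open>T\<close> is \<open>(2 * pi) ^ ?d\<close>: the cone side carries
          its square, and \<open>c\<^sup>2\<close> is its inverse, which leaves the single power on
          the side of \<open>f\<close>.\<close>
        have cancel: "inverse T * (a * T\<^sup>2 / N) = a / N * T" if "T \<noteq> 0" for a T N :: real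
          using that by (simp add: field_simps power2_eq_square)
        have eq: "c\<^sup>2 * (?w (\<gamma> + (real n - 1) / 2) \<xi> * (2 * pi) ^ (2 * ?d) / norm \<xi> ^ ?d)
            = ?w (\<gamma> + (real n - 1) / 2) \<xi> / norm \<xi> ^ ?d * (2 * pi) ^ ?d"
          unfolding c2 power_even_eq by (rule cancel) simp
        show ?thesis unfolding eq by (rule mult_right_mono[OF w[OF \<xi>]]) simp
      qed
      then have "ennreal (?w \<gamma> \<xi> * (2 * pi) ^ ?d) * A \<xi>
          \<le> ennreal (c\<^sup>2) * ennreal (?w (\<gamma> + (real n - 1) / 2) \<xi> * (2 * pi) ^ (2 * ?d) / norm \<xi> ^ ?d) * A \<xi>"
        by (intro mult_right_mono) (simp_all add: ennreal_leI flip: ennreal_mult)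
      then show "(\<integral>\<^sup>+\<eta>. ennreal ((cmod (fourier f (\<xi>, \<eta>)))\<^sup>2 * ?w \<gamma> \<xi>) \<partial>lborel) \<le> ennreal (c\<^sup>2) *
          (\<integral>\<^sup>+\<eta>. ennreal ((cmod (fourier_iter (cone_transform f) (\<xi>, \<eta>)))\<^sup>2 * ?w (\<gamma> + (real n - 1) / 2) \<xi>) \<partial>lborel)"
        using nn_integral_fourier_iter_cone_transform[OF assms(3) \<xi>, of "?w (\<gamma> + (real n - 1) / 2) \<xi>"]
        by (simp add: P A_def mult.assoc)
    qed
  qed

  \<comment> \<open>Multiplying by the surface area of the sphere turns a half-line integral with
    weight \<open>z ^ (n - 2)\<close> into an integral over the whole space, where the slice
    identities apply.\<close>
  let ?\<omega> = "emeasure (sphere_measure :: (real^'m) measure) (sphere 0 1)"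
  have \<omega>: "?\<omega> \<noteq> 0" "?\<omega> \<noteq> \<infinity>" by (rule emeasure_sphere_measure_pos_finite)+
  have R: "?\<omega> * (\<integral>\<^sup>+z\<in>{0..}. ennreal ((cmod (fourier_fst F (\<xi>, z)))\<^sup>2 * ?w \<gamma> \<xi> * z ^ (n - 2)) \<partial>lborel)
      = ennreal (?w \<gamma> \<xi>) * A \<xi>" for \<xi>
  proof -
    have "?\<omega> * (\<integral>\<^sup>+z\<in>{0..}. ennreal ((cmod (fourier_fst F (\<xi>, z)))\<^sup>2 * ?w \<gamma> \<xi> * z ^ (DIM(real^'m) - 1)) \<partial>lborel)
        = ennreal (?w \<gamma> \<xi>) * (\<integral>\<^sup>+y. ennreal ((cmod (fourier_fst f (\<xi>, y)))\<^sup>2) \<partial>lborel)"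
    proof (rule nn_integral_radial_slice)
      show "(\<lambda>y. fourier_fst f (\<xi>, y)) \<in> borel_measurable borel" by measurable
    qed (auto intro: fourier_fst_radial[OF assms(3)] simp: fourier_fst_def assms(4))
    then show ?thesis by (simp add: d A_def)
  qed
  \<comment> \<open>Plancherel leads back from \<open>fourier f\<close> to the partial transform,
    which is the source of the single power of \<open>2 * pi\<close>; the power of
    \<open>norm \<xi>\<close> is the Jacobian of the dilation.\<close>
  have S: "?\<omega> * (\<integral>\<^sup>+z\<in>{0..}. ennreal ((cmod (fourier_fst (radial_cone_transform F) (\<xi>, z)))\<^sup>2 * w * z ^ (n - 2)) \<partial>lborel)
      = ennreal (w * (2 * pi) ^ ?d / norm \<xi> ^ ?d) * A \<xi>" if \<xi>: "\<xi> \<noteq> 0" and w: "0 \<le> w" for \<xi> w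
  proof -
    \<comment> \<open>Any index serves: its axis vector is the unit vector that realizes a radius as
      a norm.\<close>
    obtain i :: 'm where True by blast
    have H: "fourier_fst (radial_cone_transform F) (\<xi>, norm y) = fourier f (\<xi>, norm \<xi> *\<^sub>R y)" for y
    proof -
      have "fourier_fst (radial_cone_transform F) (\<xi>, norm y)
          = fourier_fst (cone_transform f) (\<xi>, norm y *\<^sub>R axis i 1)"
        by (simp add: fourier_fst_def radial_cone_transform_eq[OF f assms(4), where e="axis i 1"])
      also have "\<dots> = fourier f (\<xi>, norm \<xi> *\<^sub>R y)"
        unfolding fourier_fst_cone_transform_radial[OF assms(3)]
        by (rule fourier_radial[OF assms(3)]) simp
      finally show ?thesis .
    qed
    have scale: "(\<integral>\<^sup>+y. ennreal ((cmod (fourier f (\<xi>, y)))\<^sup>2) \<partial>lborel)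
        = ennreal (norm \<xi> ^ ?d) * (\<integral>\<^sup>+y. ennreal ((cmod (fourier f (\<xi>, norm \<xi> *\<^sub>R y)))\<^sup>2) \<partial>lborel)"
      using nn_integral_lborel_affine[of "\<lambda>y. ennreal ((cmod (fourier f (\<xi>, y)))\<^sup>2)" "norm \<xi>" 0] \<xi> by simp
    have "(\<integral>\<^sup>+y. ennreal ((cmod (fourier f (\<xi>, norm \<xi> *\<^sub>R y)))\<^sup>2) \<partial>lborel)
        = ennreal (inverse (norm \<xi> ^ ?d)) * (\<integral>\<^sup>+y. ennreal ((cmod (fourier f (\<xi>, y)))\<^sup>2) \<partial>lborel)"
      unfolding scale using \<xi> by (simp add: mult.assoc[symmetric] flip: ennreal_mult)
    also have "\<dots> = ennreal ((2 * pi) ^ ?d / norm \<xi> ^ ?d) * A \<xi>"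
      unfolding plancherel_slice[OF f] A_def
      by (simp add: divide_inverse ennreal_mult mult_ac)
    finally have B: "(\<integral>\<^sup>+y. ennreal ((cmod (fourier f (\<xi>, norm \<xi> *\<^sub>R y)))\<^sup>2) \<partial>lborel)
        = ennreal ((2 * pi) ^ ?d / norm \<xi> ^ ?d) * A \<xi>" .
    have "?\<omega> * (\<integral>\<^sup>+z\<in>{0..}. ennreal ((cmod (fourier_fst (radial_cone_transform F) (\<xi>, z)))\<^sup>2 * w * z ^ (DIM(real^'m) - 1)) \<partial>lborel)
        = ennreal w * (\<integral>\<^sup>+y. ennreal ((cmod (fourier f (\<xi>, norm \<xi> *\<^sub>R y)))\<^sup>2) \<partial>lborel)"
      by (rule nn_integral_radial_slice) (auto simp: H w intro!: fourier_radial[OF assms(3)])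
    then show ?thesis
      using w by (simp add: d B mult.assoc[symmetric] flip: ennreal_mult)
  qed
  have cancel: "P \<le> ennreal r * Q" if "?\<omega> * P \<le> ennreal r * (?\<omega> * Q)" for P Q r
    using that \<omega> by (simp add: mult.left_commute[of _ ?\<omega>] ennreal_mult_le_mult_iff)
  \<comment> \<open>Measurability in \<open>\<xi>\<close> is obtained by dividing the identity
    \<open>R\<close> by the surface area, because \<open>F\<close> is known only through
    \<open>f\<close> and only at nonnegative radii.\<close>
  have Rm: "(\<lambda>\<xi>. \<integral>\<^sup>+z\<in>{0..}. ennreal ((cmod (fourier_fst F (\<xi>, z)))\<^sup>2 * ?w \<gamma> \<xi> * z ^ (n - 2)) \<partial>lborel) \<in> borel_measurable borel"
  proof -
    have "(\<integral>\<^sup>+z\<in>{0..}. ennreal ((cmod (fourier_fst F (\<xi>, z)))\<^sup>2 * ?w \<gamma> \<xi> * z ^ (n - 2)) \<partial>lborel)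
        = ennreal (?w \<gamma> \<xi>) * A \<xi> / ?\<omega>" for \<xi>
      unfolding R[symmetric] using \<omega>
      by (simp add: ennreal_mult_divide_eq mult.commute[of ?\<omega>])
    then show ?thesis by simp
  qed
  have 2: "radial_norm \<gamma> (n - 2) F \<le> ennreal c * radial_norm (\<gamma> + (real n - 1) / 2) (n - 2) (radial_cone_transform F)"
    unfolding radial_norm_def
  proof (rule ennreal_sqrt_nn_integral_le[OF _ c], goal_cases)
    case 1
    show ?case using Rm by simp
  next
    case 2
    show ?case
    proof (rule AE_neq_0, rule cancel)
      fix \<xi> :: "real^'m" assume \<xi>: "\<xi> \<noteq> 0"
      have "?w \<gamma> \<xi> \<le> c\<^sup>2 * (?w (\<gamma> + (real n - 1) / 2) \<xi> * (2 * pi) ^ ?d / norm \<xi> ^ ?d)"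
      proof -
        have cancel: "inverse T * (a * T / N) = a / N" if "T \<noteq> 0" for a T N :: real
          using that by (simp add: field_simps)
        have eq: "c\<^sup>2 * (?w (\<gamma> + (real n - 1) / 2) \<xi> * (2 * pi) ^ ?d / norm \<xi> ^ ?d)
            = ?w (\<gamma> + (real n - 1) / 2) \<xi> / norm \<xi> ^ ?d"
          unfolding c2 by (rule cancel) simp
        show ?thesis unfolding eq by (rule w[OF \<xi>])
      qed
      then have "ennreal (?w \<gamma> \<xi>) * A \<xi>
          \<le> ennreal (c\<^sup>2) * ennreal (?w (\<gamma> + (real n - 1) / 2) \<xi> * (2 * pi) ^ ?d / norm \<xi> ^ ?d) * A \<xi>"
        by (intro mult_right_mono) (simp_all add: ennreal_leI flip: ennreal_mult)
      then show "?\<omega> * (\<integral>\<^sup>+z\<in>{0..}. ennreal ((cmod (fourier_fst F (\<xi>, z)))\<^sup>2 * ?w \<gamma> \<xi> * z ^ (n - 2)) \<partial>lborel)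
          \<le> ennreal (c\<^sup>2) * (?\<omega> * (\<integral>\<^sup>+z\<in>{0..}. ennreal ((cmod (fourier_fst (radial_cone_transform F) (\<xi>, z)))\<^sup>2
              * ?w (\<gamma> + (real n - 1) / 2) \<xi> * z ^ (n - 2)) \<partial>lborel))"
        unfolding R by (subst S[OF \<xi>]) (simp_all add: mult.assoc)
    qed
  qed
  from 1 2 show ?thesis unfolding c_def by blast
qed

end
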